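(* Let $\mathfrak g=\mathfrak{sp}_{2n}$ and let $\mathfrak n$ be a nilradical in $\mathfrak g$ with $\mathcal K(\mathfrak n)=\{\beta_1,\dots,\beta_k\}$. Identify the abelian nilradical $\mathfrak n_{\{\alpha_n\}}$ with the space of $n\times n$ matrices that are symmetric with respect to the antidiagonal. Then $\mathcal F(\mathfrak n)$ is equal to the north-east $k\times k$ square in $\mathfrak n_{\{\alpha_n\}}$ (i.e., $\mathcal F(\mathfrak n)=\bigoplus_{1\le i\le j\le k}\mathfrak g_{\varepsilon_i+\varepsilon_j}$), and $\dim\mathcal F(\mathfrak n)=k(k+1)/2$.
   Context: Everything is over $\mathbb C$. For a square matrix $A$ let $\hat A$ be its transpose with respect to the antidiagonal, and realise $$\mathfrak{sp}_{2n}=\Bigl\{\begin{pmatrix} A & M \\ M' & -\hat A \end{pmatrix}\ \Big|\ M=\hat M,\ M'=\hat M'\Bigr\}$$ with $n\times n$ blocks; the fixed Borel subalgebra is the set of upper-triangular matrices in it and $\mathfrak t=\{\mathrm{diag}(\varepsilon_1,\dots,\varepsilon_n,-\varepsilon_n,\dots,-\varepsilon_1)\}$. Simple roots: $\Pi=\{\alpha_1,\dots,\alpha_n\}$, $\alpha_i=\varepsilon_i-\varepsilon_{i+1}$ ($i<n$), $\alpha_n=2\varepsilon_n$. $\mathfrak g_\gamma$ is the root space of $\gamma$; $[\gamma:\alpha]$ is the coefficient of $\alpha\in\Pi$ in $\gamma$. For nonempty $\mathcal T\subset\Pi$, $\mathfrak n_{\mathcal T}=\bigoplus\mathfrak g_\gamma$,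 the sum over all positive roots $\gamma$ with $[\gamma:\alpha]>0$ for some $\alpha\in\mathcal T$; "nilradical" means a nonzero nilradical of a standard parabolic subalgebra, i.e. some $\mathfrak n_{\mathcal T}$. $\mathfrak n_{\{\alpha_n\}}=\{\begin{pmatrix} 0 & M \\ 0 & 0 \end{pmatrix}\mid M=\hat M\}$, with roots $\varepsilon_i+\varepsilon_j$, $1\le i\le j\le n$. The Kostant cascade of $\mathfrak{sp}_{2n}$ is $\mathcal K=\{\beta_1,\dots,\beta_n\}$, $\beta_i=2\varepsilon_i$. Put $\mathcal K(\mathfrak n)=\mathcal K\cap\Delta(\mathfrak n)$, $\Delta(\mathfrak n)$ being the set of roots of $\mathfrak n$; it is always of the form $\{\beta_1,\dots,\beta_k\}$, $1\le k\le n$. For a Lie algebra $\mathfrak q$, $\mathfrak q^*_{\rm reg}$ is the set of $\xi\in\mathfrak q^*$ whose stabiliser $\mathfrak q^\xi$ has minimal dimension; the Frobenius semiradical is $\mathcal F(\mathfrak q)=\sum_{\xi\in\mathfrak q^*_{\rm reg}}\mathfrak q^\xi$. *)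

theory Defs
  imports Complex_Main "Jordan_Normal_Form.VS_Connect"
begin

section \<open>Linear algebra in the space of complex square matrices\<close>

abbreviation mat_space :: "nat \<Rightarrow> (complex, complex mat) module" where
  "mat_space N \<equiv> module_mat TYPE(complex) N N"

definition mat_span :: "nat \<Rightarrow> complex mat set \<Rightarrow> complex mat set" where
  "mat_span N S = LinearCombinations.module.span class_ring (mat_space N) S"

definition mat_dim :: "nat \<Rightarrow> complex mat set \<Rightarrow> nat" where
  "mat_dim N V = vectorspace.dim class_ring (mat_space N\<lparr>carrier := V\<rparr>)"

text \<open>The sum of a (possibly infinite) family of subspaces is the span of their union.\<close>

definition subspaces_sum :: "nat \<Rightarrow> 'i set \<Rightarrow> ('i \<Rightarrow> complex mat set) \<Rightarrow> complex mat set" where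
  "subspaces_sum N I W = mat_span N (\<Union>i\<in>I. W i)"

definition is_internal_direct_sum ::
    "nat \<Rightarrow> complex mat set \<Rightarrow> 'i set \<Rightarrow> ('i \<Rightarrow> complex mat set) \<Rightarrow> bool" where
  "is_internal_direct_sum N V I W \<longleftrightarrow>
     V = subspaces_sum N I W \<and>
     (\<forall>f \<in> Pi I W. finsum (mat_space N) f I = 0\<^sub>m N N \<longrightarrow> (\<forall>i\<in>I. f i = 0\<^sub>m N N))"

section \<open>Frobenius semiradical of a Lie algebra of matrices\<close>

definition bracket :: "complex mat \<Rightarrow> complex mat \<Rightarrow> complex mat" where
  "bracket x y = x * y - y * x"

definition dual_space :: "complex mat set \<Rightarrow> (complex mat \<Rightarrow> complex) set" where
  "dual_space \<qq> = {\<xi> \<in> extensional \<qq>.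
     (\<forall>x\<in>\<qq>. \<forall>y\<in>\<qq>. \<xi> (x + y) = \<xi> x + \<xi> y) \<and>
     (\<forall>c. \<forall>x\<in>\<qq>. \<xi> (c \<cdot>\<^sub>m x) = c * \<xi> x)}"

text \<open>Stabiliser for the coadjoint action: \<open>(ad* x) \<xi> = - \<xi> \<circ> ad x\<close>.\<close>

definition stabiliser :: "complex mat set \<Rightarrow> (complex mat \<Rightarrow> complex) \<Rightarrow> complex mat set" where
  "stabiliser \<qq> \<xi> = {x \<in> \<qq>. \<forall>y\<in>\<qq>. \<xi> (bracket x y) = 0}"

definition dual_reg :: "nat \<Rightarrow> complex mat set \<Rightarrow> (complex mat \<Rightarrow> complex) set" where
  "dual_reg N \<qq> = {\<xi> \<in> dual_space \<qq>.
     \<forall>\<eta> \<in> dual_space \<qq>. mat_dim N (stabiliser \<qq> \<xi>) \<le> mat_dim N (stabiliser \<qq> \<eta>)}"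

definition frobenius_semiradical :: "nat \<Rightarrow> complex mat set \<Rightarrow> complex mat set" where
  "frobenius_semiradical N \<qq> = subspaces_sum N (dual_reg N \<qq>) (stabiliser \<qq>)"

section \<open>The symplectic Lie algebra\<close>

definition antitranspose :: "complex mat \<Rightarrow> complex mat" where
  "antitranspose A = mat (dim_col A) (dim_row A)
     (\<lambda>(i, j). A $$ (dim_row A - 1 - j, dim_col A - 1 - i))"

definition sp :: "nat \<Rightarrow> complex mat set" where
  "sp n = {four_block_mat A M M' (- antitranspose A) | A M M'.
     A \<in> carrier_mat n n \<and> M \<in> carrier_mat n n \<and> M' \<in> carrier_mat n n \<and>
     M = antitranspose M \<and> M' = antitranspose M'}"

definition borel :: "nat \<Rightarrow> complex mat set" where
  "borel n = {x \<in> sp n. upper_triangular x}"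

text \<open>Matrix rows and columns are indexed from 0, so entry \<open>i < n\<close> of the diagonal
  is the paper's \<open>\<epsilon>\<^bsub>i+1\<^esub>\<close>.\<close>

definition torus :: "nat \<Rightarrow> complex mat set" where
  "torus n = {mat_diag (2 * n) (\<lambda>i. if i < n then d i else - d (2 * n - 1 - i)) | d. True}"

text \<open>A weight, i.e. a linear form on the torus, is given by the vector of its coordinates
  in the basis \<open>\<epsilon>\<^sub>1, \<dots>, \<epsilon>\<^sub>n\<close>.\<close>

definition weight_eval :: "nat \<Rightarrow> complex vec \<Rightarrow> complex mat \<Rightarrow> complex" where
  "weight_eval n \<gamma> h = (\<Sum>i<n. \<gamma> $ i * h $$ (i, i))"

definition root_space :: "nat \<Rightarrow> complex vec \<Rightarrow> complex mat set" where
  "root_space n \<gamma> = {x \<in> sp n. \<forall>h \<in> torus n. bracket h x = weight_eval n \<gamma> h \<cdot>\<^sub>m x}"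

definition roots :: "nat \<Rightarrow> complex vec set" where
  "roots n = {\<gamma> \<in> carrier_vec n. \<gamma> \<noteq> 0\<^sub>v n \<and> root_space n \<gamma> \<noteq> {0\<^sub>m (2 * n) (2 * n)}}"

definition positive_roots :: "nat \<Rightarrow> complex vec set" where
  "positive_roots n = {\<gamma> \<in> roots n. root_space n \<gamma> \<subseteq> borel n}"

text \<open>\<open>\<epsilon>\<^sub>i\<close>, \<open>\<alpha>\<^sub>i\<close> and \<open>\<beta>\<^sub>i\<close> below are indexed by \<open>1 \<le> i \<le> n\<close>.\<close>

definition eps :: "nat \<Rightarrow> nat \<Rightarrow> complex vec" where
  "eps n i = unit_vec n (i - 1)"

definition simple_root :: "nat \<Rightarrow> nat \<Rightarrow> complex vec" where
  "simple_root n i = (if i < n then eps n i - eps n (i + 1) else 2 \<cdot>\<^sub>v eps n n)"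

definition simple_roots :: "nat \<Rightarrow> complex vec set" where
  "simple_roots n = simple_root n ` {1..n}"

definition root_coeff :: "nat \<Rightarrow> complex vec \<Rightarrow> complex vec \<Rightarrow> int" where
  "root_coeff n \<gamma> \<alpha> = (THE m. \<exists>c :: complex vec \<Rightarrow> int. c \<alpha> = m \<and>
     \<gamma> = finsum_vec TYPE(complex) n (\<lambda>\<delta>. of_int (c \<delta>) \<cdot>\<^sub>v \<delta>) (simple_roots n))"

definition kostant_root :: "nat \<Rightarrow> nat \<Rightarrow> complex vec" where
  "kostant_root n i = 2 \<cdot>\<^sub>v eps n i"

definition kostant_cascade :: "nat \<Rightarrow> complex vec set" where
  "kostant_cascade n = kostant_root n ` {1..n}"

section \<open>Nilradicals of standard parabolic subalgebras\<close>

definition nilradical :: "nat \<Rightarrow> complex vec set \<Rightarrow> complex mat set" where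
  "nilradical n T = subspaces_sum (2 * n)
     {\<gamma> \<in> positive_roots n. \<exists>\<alpha>\<in>T. root_coeff n \<gamma> \<alpha> > 0} (root_space n)"

definition is_nilradical :: "nat \<Rightarrow> complex mat set \<Rightarrow> bool" where
  "is_nilradical n \<nn> \<longleftrightarrow> (\<exists>T. T \<noteq> {} \<and> T \<subseteq> simple_roots n \<and> \<nn> = nilradical n T)"

definition roots_of :: "nat \<Rightarrow> complex mat set \<Rightarrow> complex vec set" where
  "roots_of n \<nn> = {\<gamma> \<in> roots n. root_space n \<gamma> \<subseteq> \<nn>}"

text \<open>The identification of \<open>M\<close> with the block matrix having \<open>M\<close> in its upper right corner.\<close>

definition upper_right :: "nat \<Rightarrow> complex mat \<Rightarrow> complex mat" where
  "upper_right n M = four_block_mat (0\<^sub>m n n) M (0\<^sub>m n n) (0\<^sub>m n n)"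

text \<open>The matrices in the abelian nilradical \<open>\<nn>\<^bsub>{\<alpha>\<^sub>n}\<^esub>\<close> whose block \<open>M\<close> vanishes
  outside the first \<open>k\<close> rows and last \<open>k\<close> columns.\<close>

definition north_east_square :: "nat \<Rightarrow> nat \<Rightarrow> complex mat set" where
  "north_east_square n k = {upper_right n M | M.
     M \<in> carrier_mat n n \<and> upper_right n M \<in> nilradical n {simple_root n n} \<and>
     (\<forall>i<n. \<forall>j<n. M $$ (i, j) \<noteq> 0 \<longrightarrow> i < k \<and> n - k \<le> j)}"

end

theory Submission
  imports Defs
begin

text \<open>
  With \<open>k\<close> the largest index of a simple root in the defining set, the
  nilradical \<open>\<qq>\<close> consists of triples \<open>(u, a, s)\<close>: a block strictly upper triangular
  \<open>k \<times> k\<close> matrix \<open>u\<close>, an arbitrary \<open>k \<times> 2(n - k)\<close> matrix \<open>a\<close>, and the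
  \<open>k \<times> k\<close> corner \<open>s\<close>.  For every \<open>\<eta> \<in> \<qq>\<^sup>*\<close> the elements \<open>s\<close> of the corner that
  stabilise \<open>\<eta>\<close> are cut out by one linear equation for each coordinate of \<open>u\<close>, so their space has
  dimension at least \<open>d = k(k+1)/2 - m\<close>, where \<open>m\<close> is the number of these coordinates.  If \<open>\<eta>\<close> is the linear form of a symmetric \<open>k \<times> k\<close>
  matrix \<open>F = g\<^sup>Tg\<close>, with \<open>g\<close> upper unitriangular, then the stabiliser lies in the corner
  (a strictly upper triangular matrix that is skew for \<open>F\<close> vanishes) and has dimension \<open>d\<close>.  So
  \<open>d\<close> is the minimal dimension, and every regular stabiliser lies in the corner.  Conversely,
  if \<open>Fv\<close> is the \<open>j\<close>th basis vector and \<open>v\<close> is supported on the first \<open>j\<close> coordinates, then the corner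
  matrix \<open>vv\<^sup>T\<close> stabilises the form of \<open>F\<close>; these matrices span the corner.
\<close>

section \<open>Subspaces of the space of matrices\<close>

text \<open>The members of the defining set below \<open>k\<close> are arbitrary. They decide which
  \<open>u\<close> occur, hence \<open>m\<close>, \<open>d\<close> and the stabilisers themselves,
  and yet the sum of the regular stabilisers must not depend on them. The equations for
  \<open>s\<close> come from \<open>u\<close> alone because the corner commutes with the
  \<open>a\<close> and \<open>s\<close> parts. The lower bound \<open>d\<close> is proved for the
  intersection of a stabiliser with the corner, so a stabiliser of dimension \<open>d\<close> has no
  room outside the corner; this is how a few special forms control all regular ones. The factor
  \<open>g\<close> is upper unitriangular so that conjugation by it preserves strictly upper
  triangular matrices; a skew matrix of that shape is zero. The identity form reaches only block
  diagonal corner matrices. With \<open>g = 1 - \<mu> E_ij\<close> the vector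
  \<open>g^-1 e_j = e_j + \<mu> e_i\<close> gives mixed squares, and polarisation yields the
  remaining root vectors.\<close>

definition mat_subspace :: "nat \<Rightarrow> complex mat set \<Rightarrow> bool" where
  "mat_subspace N W \<longleftrightarrow> W \<subseteq> carrier_mat N N \<and> 0\<^sub>m N N \<in> W \<and>
     (\<forall>x\<in>W. \<forall>y\<in>W. x + y \<in> W) \<and> (\<forall>c. \<forall>x\<in>W. c \<cdot>\<^sub>m x \<in> W)"

definition mat_linear :: "complex mat set \<Rightarrow> (complex mat \<Rightarrow> complex) \<Rightarrow> bool" where
  "mat_linear W f \<longleftrightarrow> (\<forall>x\<in>W. \<forall>y\<in>W. f (x + y) = f x + f y) \<and>
     (\<forall>c. \<forall>x\<in>W. f (c \<cdot>\<^sub>m x) = c * f x)"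

lemma mat_subspaceI:
  assumes "W \<subseteq> carrier_mat N N" "0\<^sub>m N N \<in> W"
    and "\<And>x y. x \<in> W \<Longrightarrow> y \<in> W \<Longrightarrow> x + y \<in> W"
    and "\<And>c x. x \<in> W \<Longrightarrow> c \<cdot>\<^sub>m x \<in> W"
  shows "mat_subspace N W"
  using assms unfolding mat_subspace_def by auto

lemma mat_subspaceD:
  assumes "mat_subspace N W"
  shows "W \<subseteq> carrier_mat N N" "0\<^sub>m N N \<in> W"
    and "\<And>x y. x \<in> W \<Longrightarrow> y \<in> W \<Longrightarrow> x + y \<in> W"
    and "\<And>c x. x \<in> W \<Longrightarrow> c \<cdot>\<^sub>m x \<in> W"
  using assms unfolding mat_subspace_def by auto

lemma mat_linearD:
  assumes "mat_linear W f"
  shows "\<And>x y. x \<in> W \<Longrightarrow> y \<in> W \<Longrightarrow> f (x + y) = f x + f y"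
    and "\<And>c x. x \<in> W \<Longrightarrow> f (c \<cdot>\<^sub>m x) = c * f x"
  using assms unfolding mat_linear_def by auto

lemma mat_linear_mono: "mat_linear W f \<Longrightarrow> V \<subseteq> W \<Longrightarrow> mat_linear V f"
  unfolding mat_linear_def by blast

lemma mat_linear_zero:
  assumes "mat_subspace N W" "mat_linear W f"
  shows "f (0\<^sub>m N N) = 0"
proof -
  have "f (0 \<cdot>\<^sub>m 0\<^sub>m N N) = 0 * f (0\<^sub>m N N)"
    using assms by (intro mat_linearD(2)) (auto dest: mat_subspaceD)
  thus ?thesis by simp
qed

lemma mat_subspace_Int:
  "mat_subspace N V \<Longrightarrow> mat_subspace N W \<Longrightarrow> mat_subspace N (V \<inter> W)"
  unfolding mat_subspace_def by auto

lemma mat_subspace_kernel: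
  assumes "mat_subspace N W" "mat_linear W f"
  shows "mat_subspace N {x\<in>W. f x = 0}"
  using mat_linear_zero[OF assms] assms unfolding mat_subspace_def mat_linear_def by auto

lemma mat_subspace_kernels:
  assumes "mat_subspace N W" "\<And>p. p \<in> P \<Longrightarrow> mat_linear W (f p)"
  shows "mat_subspace N {x\<in>W. \<forall>p\<in>P. f p x = 0}"
  using mat_linear_zero[OF assms] assms unfolding mat_subspace_def mat_linear_def by auto

text \<open>This bridge makes results on submodules, spans and bases available for the elementwise
  closure conditions, which are easier to check for sets of matrices.\<close>

lemma mat_subspace_submodule:
  "mat_subspace N W \<longleftrightarrow> submodule class_ring W (mat_space N)"
proof -
  interpret matrix_vs N N "TYPE(complex)" .
  have "module class_ring (mat_space N)" by unfold_locales
  thus ?thesis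
    unfolding mat_subspace_def submodule_def by (auto simp: module_mat_simps)
qed

lemma mat_subspace_imp_subspace:
  assumes "mat_subspace N W" shows "subspace class_ring W (mat_space N)"
  using assms matrix_vs unfolding mat_subspace_submodule subspace_def by blast

lemma mat_span_least:
  assumes "S \<subseteq> W" "mat_subspace N W" shows "mat_span N S \<subseteq> W"
proof -
  interpret matrix_vs N N "TYPE(complex)" .
  show ?thesis using span_is_subset assms unfolding mat_span_def mat_subspace_submodule by blast
qed

lemma mat_span_superset:
  assumes "S \<subseteq> carrier_mat N N" shows "S \<subseteq> mat_span N S"
proof -
  interpret matrix_vs N N "TYPE(complex)" .
  show ?thesis using in_own_span assms unfolding mat_span_def by blast
qed

lemma mat_subspace_span:
  assumes "S \<subseteq> carrier_mat N N" shows "mat_subspace N (mat_span N S)"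
proof -
  interpret matrix_vs N N "TYPE(complex)" .
  show ?thesis
    using span_is_submodule assms unfolding mat_span_def mat_subspace_submodule by blast
qed

lemma mat_finsum_closed:
  assumes "mat_subspace N W" "finite A" "\<And>a. a \<in> A \<Longrightarrow> f a \<in> W"
  shows "finsum (mat_space N) f A \<in> W"
proof -
  interpret matrix_vs N N "TYPE(complex)" .
  show ?thesis using assms(2,3)
  proof (induction A rule: finite_induct)
    case empty
    show ?case using mat_subspaceD(2)[OF assms(1)] by simp
  next
    case (insert a A)
    have "f \<in> A \<rightarrow> carrier_mat N N" "f a \<in> carrier_mat N N"
      using insert.prems mat_subspaceD(1)[OF assms(1)] by auto
    thus ?case using insert mat_subspaceD(3)[OF assms(1)] by simp
  qed
qed

lemma index_mat_finsum:
  assumes "finite A" "\<And>a. a \<in> A \<Longrightarrow> f a \<in> carrier_mat N N" "i < N" "j < N"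
  shows "finsum (mat_space N) f A $$ (i, j) = (\<Sum>a\<in>A. f a $$ (i, j))"
proof -
  interpret matrix_vs N N "TYPE(complex)" .
  have C: "mat_subspace N (carrier_mat N N)" by (rule mat_subspaceI) auto
  show ?thesis using assms(1,2)
  proof (induction A rule: finite_induct)
    case empty
    show ?case using assms by simp
  next
    case (insert a A)
    have "f \<in> A \<rightarrow> carrier_mat N N" "f a \<in> carrier_mat N N" using insert.prems by auto
    moreover have "finsum (mat_space N) f A \<in> carrier_mat N N"
      using insert by (intro mat_finsum_closed[OF C]) auto
    hence "dim_row (finsum (mat_space N) f A) = N" "dim_col (finsum (mat_space N) f A) = N"
      by auto
    ultimately show ?case using insert assms(3,4) by simp
  qed
qed

section \<open>Bases and dimensions of matrix subspaces\<close>

lemma mat_fin_dim: "vectorspace.fin_dim class_ring (mat_space N)"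
proof -
  interpret matrix_vs N N "TYPE(complex)" .
  define e :: "nat \<times> nat \<Rightarrow> complex mat" where
    "e = (\<lambda>(i, j). mat N N (\<lambda>p. if p = (i, j) then 1 else 0))"
  define S where "S = e ` ({..<N} \<times> {..<N})"
  have S: "S \<subseteq> carrier_mat N N" unfolding S_def e_def by auto
  have "x \<in> mat_span N S" if x: "x \<in> carrier_mat N N" for x
  proof -
    let ?y = "finsum (mat_space N) (\<lambda>p. x $$ p \<cdot>\<^sub>m e p) ({..<N} \<times> {..<N})"
    have y: "?y \<in> mat_span N S"
      using mat_span_superset[OF S] mat_subspaceD(4)[OF mat_subspace_span[OF S]]
      by (intro mat_finsum_closed[OF mat_subspace_span[OF S]]) (auto simp: S_def)
    have "x = ?y"
    proof (rule eq_matI)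
      fix i j assume ij: "i < dim_row ?y" "j < dim_col ?y"
      moreover have "?y \<in> carrier_mat N N"
        using y mat_subspaceD(1)[OF mat_subspace_span[OF S]] by blast
      ultimately have ij: "i < N" "j < N" by auto
      have "?y $$ (i, j) = (\<Sum>p\<in>{..<N} \<times> {..<N}. (x $$ p \<cdot>\<^sub>m e p) $$ (i, j))"
        using ij by (intro index_mat_finsum) (auto simp: e_def)
      also have "\<dots> = (\<Sum>p\<in>{..<N} \<times> {..<N}. if p = (i, j) then x $$ p else 0)"
        using ij by (intro sum.cong) (auto simp: e_def)
      also have "\<dots> = x $$ (i, j)" using ij by simp
      finally show "x $$ (i, j) = ?y $$ (i, j)" by simp
    qed (use x y mat_subspaceD(1)[OF mat_subspace_span[OF S]] in auto)
    thus ?thesis using y by simp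
  qed
  hence "span S = carrier_mat N N"
    using S mat_subspaceD(1)[OF mat_subspace_span[OF S]] unfolding mat_span_def by blast
  moreover have "finite S" unfolding S_def by simp
  ultimately show ?thesis using S unfolding fin_dim_def by auto
qed

text \<open>\<open>mat_dim\<close> refers to the space with carrier \<open>W\<close>, while later
  arguments stay in the ambient space. A maximal independent subset of \<open>W\<close> serves both,
  since independence and span do not change when the carrier shrinks to a submodule.\<close>

lemma mat_subspace_basis:
  assumes "mat_subspace N W"
  obtains B where "finite B" "B \<subseteq> W" "\<not> module.lin_dep class_ring (mat_space N) B"
    "mat_span N B = W" "card B = mat_dim N W"
proof -
  interpret matrix_vs N N "TYPE(complex)" .
  interpret W: vectorspace class_ring "mat_space N\<lparr>carrier := W\<rparr>"
    by (rule subspace_is_vs[OF mat_subspace_imp_subspace[OF assms]])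
  note sub = assms[unfolded mat_subspace_submodule]
  have W: "W \<subseteq> carrier_mat N N" using mat_subspaceD(1)[OF assms] .
  have li: "W.lin_dep B = lin_dep B" if "B \<subseteq> W" for B
    using span_li_not_depend(2)[OF that sub] by blast
  define Q where "Q = (\<lambda>B. B \<subseteq> W \<and> \<not> lin_dep B)"
  have "finite B \<and> card B \<le> dim" if "Q B" for B
    using li_le_dim[OF mat_fin_dim, of B] that W unfolding Q_def by auto
  moreover have "Q {}" unfolding Q_def lin_dep_def by auto
  ultimately have "\<exists>B. finite B \<and> maximal B Q"
    using maximal_exists[where P = Q and N = dim and B = "{}"] by blast
  then obtain B where B: "finite B" "maximal B Q" by blast
  have "(\<lambda>S. S \<subseteq> carrier (mat_space N\<lparr>carrier := W\<rparr>) \<and> \<not> W.lin_dep S) = Q"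
    unfolding Q_def using li by (intro ext) auto
  with B(2) have "maximal B (\<lambda>S. S \<subseteq> carrier (mat_space N\<lparr>carrier := W\<rparr>) \<and> \<not> W.lin_dep S)"
    by simp
  hence bas: "W.basis B" by (rule W.max_li_is_basis)
  have BW: "B \<subseteq> W" and nB: "\<not> lin_dep B" using B(2) unfolding maximal_def Q_def by auto
  have "W.dim = card B" by (rule W.dim_basis[OF B(1) bas])
  moreover have "span B = W"
    using bas span_li_not_depend(1)[OF BW sub] unfolding W.basis_def by simp
  ultimately show ?thesis
    using that[of B] B(1) BW nB unfolding mat_dim_def mat_span_def by simp
qed

text \<open>Steinitz exchange: at most \<open>card B - card A\<close> vectors complete
  \<open>A\<close> to a set with the span of \<open>B\<close>, so nothing is added when the
  cardinalities agree.\<close>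

lemma mat_exchange:
  assumes "finite A" "finite B" "B \<subseteq> carrier_mat N N"
    and "\<not> module.lin_dep class_ring (mat_space N) A" "A \<subseteq> mat_span N B"
  shows "card A \<le> card B" "card A = card B \<Longrightarrow> mat_span N A = mat_span N B"
proof -
  interpret matrix_vs N N "TYPE(complex)" .
  obtain C where C: "finite C" "int (card C) \<le> int (card B) - int (card A)"
    "span (A \<union> C) = span B"
    using replacement[OF assms(1-4)] assms(5) unfolding mat_span_def by blast
  show "card A \<le> card B" using C(2) by linarith
  assume "card A = card B"
  hence "C = {}" using C by simp
  thus "mat_span N A = mat_span N B" using C(3) unfolding mat_span_def by simp
qed

lemma mat_dim_mono:
  assumes "mat_subspace N V" "mat_subspace N W" "V \<subseteq> W"
  shows "mat_dim N V \<le> mat_dim N W" "mat_dim N V = mat_dim N W \<Longrightarrow> V = W"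
proof -
  obtain A where A: "finite A" "A \<subseteq> V" "\<not> module.lin_dep class_ring (mat_space N) A"
    "mat_span N A = V" "card A = mat_dim N V" using mat_subspace_basis[OF assms(1)] .
  obtain B where B: "finite B" "B \<subseteq> W" "\<not> module.lin_dep class_ring (mat_space N) B"
    "mat_span N B = W" "card B = mat_dim N W" using mat_subspace_basis[OF assms(2)] .
  have BC: "B \<subseteq> carrier_mat N N" and AW: "A \<subseteq> mat_span N B"
    using A B assms(3) mat_subspaceD(1)[OF assms(2)] by auto
  note * = mat_exchange[OF A(1) B(1) BC A(3) AW]
  show "mat_dim N V \<le> mat_dim N W" "mat_dim N V = mat_dim N W \<Longrightarrow> V = W"
    using * A B by auto
qed

lemma mat_dim_zero: "mat_dim N {0\<^sub>m N N} = 0"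
proof -
  interpret matrix_vs N N "TYPE(complex)" .
  have "mat_subspace N {0\<^sub>m N N}" by (rule mat_subspaceI) auto
  then obtain B where B: "B \<subseteq> {0\<^sub>m N N}" "\<not> lin_dep B"
    "card B = mat_dim N {0\<^sub>m N N}" by (rule mat_subspace_basis)
  have "0\<^sub>m N N \<notin> B" using vs_zero_lin_dep[of B] B by auto
  hence "B = {}" using B(1) by blast
  thus ?thesis using B(3) by simp
qed

text \<open>If \<open>f v\<close> is nonzero, every \<open>x\<close> differs from an element of the
  kernel by a multiple of \<open>v\<close>, so \<open>v\<close> and a basis of the kernel span
  \<open>W\<close>.\<close>

lemma mat_dim_kernel:
  assumes W: "mat_subspace N W" and f: "mat_linear W f"
  shows "mat_dim N W \<le> mat_dim N {x\<in>W. f x = 0} + 1"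
proof (cases "\<forall>x\<in>W. f x = 0")
  case True
  hence "{x\<in>W. f x = 0} = W" by auto
  thus ?thesis by simp
next
  case False
  then obtain v where v: "v \<in> W" "f v \<noteq> 0" by blast
  let ?K = "{x\<in>W. f x = 0}"
  note WD = mat_subspaceD[OF W]
  obtain B where B: "finite B" "B \<subseteq> ?K" "mat_span N B = ?K" "card B = mat_dim N ?K"
    by (rule mat_subspace_basis[OF mat_subspace_kernel[OF W f]])
  obtain A where A: "finite A" "A \<subseteq> W" "\<not> module.lin_dep class_ring (mat_space N) A"
    "card A = mat_dim N W" by (rule mat_subspace_basis[OF W])
  have C: "insert v B \<subseteq> carrier_mat N N" using B(2) v WD(1) by auto
  note SD = mat_subspaceD[OF mat_subspace_span[OF C]]
  have vS: "v \<in> mat_span N (insert v B)" and BS: "B \<subseteq> mat_span N (insert v B)"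
    using mat_span_superset[OF C] by auto
  have KS: "?K \<subseteq> mat_span N (insert v B)"
    using mat_span_least[OF BS mat_subspace_span[OF C]] B(3) by simp
  have "x \<in> mat_span N (insert v B)" if x: "x \<in> W" for x
  proof -
    define c where "c = f x / f v"
    have cv: "(- c) \<cdot>\<^sub>m v \<in> W" using WD(4) v by blast
    have "f (x + (- c) \<cdot>\<^sub>m v) = 0"
      using mat_linearD(1)[OF f x cv] mat_linearD(2)[OF f v(1)] v(2) by (simp add: c_def)
    hence "x + (- c) \<cdot>\<^sub>m v \<in> mat_span N (insert v B)" using KS WD(3)[OF x cv] by blast
    moreover have "c \<cdot>\<^sub>m v \<in> mat_span N (insert v B)" using SD(4) vS by blast
    ultimately have "(x + (- c) \<cdot>\<^sub>m v) + c \<cdot>\<^sub>m v \<in> mat_span N (insert v B)"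
      using SD(3) by blast
    moreover have "(x + (- c) \<cdot>\<^sub>m v) + c \<cdot>\<^sub>m v = x"
    proof -
      have "x \<in> carrier_mat N N" "v \<in> carrier_mat N N" using x v WD(1) by auto
      thus ?thesis by (intro eq_matI) auto
    qed
    ultimately show ?thesis by simp
  qed
  hence "A \<subseteq> mat_span N (insert v B)" using A(2) by blast
  hence "card A \<le> card (insert v B)" using mat_exchange(1)[OF A(1) _ C A(3)] B(1) by simp
  also have "\<dots> \<le> card B + 1" using B(1) by (simp add: card_insert_if)
  finally show ?thesis using A(4) B(4) by simp
qed

lemma mat_dim_kernels:
  assumes "finite P" and W: "mat_subspace N W" and f: "\<And>p. p \<in> P \<Longrightarrow> mat_linear W (f p)"
  shows "mat_dim N W \<le> mat_dim N {x\<in>W. \<forall>p\<in>P. f p x = 0} + card P"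
  using assms(1) f
proof (induction P rule: finite_induct)
  case empty
  show ?case by simp
next
  case (insert p P)
  let ?K = "{x\<in>W. \<forall>p\<in>P. f p x = 0}"
  have K: "mat_subspace N ?K" using insert.prems by (intro mat_subspace_kernels[OF W]) auto
  have "mat_linear ?K (f p)"
    using insert.prems by (intro mat_linear_mono[of W "f p" ?K]) auto
  from mat_dim_kernel[OF K this]
  have "mat_dim N ?K \<le> mat_dim N {x\<in>W. \<forall>q\<in>insert p P. f q x = 0} + 1"
    by (simp add: conj_ac)
  thus ?case using insert by simp
qed

text \<open>Passing to the kernel of \<open>f p\<close> loses \<open>e p\<close>, so the dimension
  drops strictly, while all other \<open>e q\<close> survive for the induction.\<close>

lemma mat_dim_ge_card:
  assumes "finite P" "mat_subspace N W" "\<And>p. p \<in> P \<Longrightarrow> mat_linear W (f p)"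
    and "\<And>p. p \<in> P \<Longrightarrow> e p \<in> W" "\<And>p. p \<in> P \<Longrightarrow> f p (e p) \<noteq> 0"
    and "\<And>p q. p \<in> P \<Longrightarrow> q \<in> P \<Longrightarrow> p \<noteq> q \<Longrightarrow> f p (e q) = 0"
  shows "card P \<le> mat_dim N W"
  using assms
proof (induction P arbitrary: W rule: finite_induct)
  case empty
  show ?case by simp
next
  case (insert p P)
  note W = insert.prems(1)
  have fp: "mat_linear W (f p)" using insert.prems(2) by simp
  let ?K = "{x\<in>W. f p x = 0}"
  have K: "mat_subspace N ?K" by (rule mat_subspace_kernel[OF W fp])
  have "card P \<le> mat_dim N ?K"
  proof (rule insert.IH[OF K])
    show "mat_linear ?K (f q)" if "q \<in> P" for q
      using insert.prems(2)[of q] that by (intro mat_linear_mono[of W "f q" ?K]) auto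
    show "e q \<in> ?K" if "q \<in> P" for q
      using insert.prems(3)[of q] insert.prems(5)[of p q] insert.hyps(2) that by auto
    show "f q (e q) \<noteq> 0" if "q \<in> P" for q using insert.prems(4)[of q] that by auto
    show "f q (e r) = 0" if "q \<in> P" "r \<in> P" "q \<noteq> r" for q r
      using insert.prems(5)[of q r] that by auto
  qed
  moreover have "?K \<noteq> W" using insert.prems(3,4)[of p] by auto
  hence "mat_dim N ?K < mat_dim N W"
    using mat_dim_mono[OF K W] by (auto simp: le_less)
  ultimately show ?case using insert.hyps by simp
qed

section \<open>Root vectors of the symplectic Lie algebra\<close>

text \<open>With this reversal of indices, the mirror image of the position \<open>(r, c)\<close> in
  the antidiagonal is \<open>(opp n c, opp n r)\<close>.\<close>

definition opp :: "nat \<Rightarrow> nat \<Rightarrow> nat" where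
  "opp n r = 2 * n - 1 - r"

text \<open>The signs of the alternating form whose Gram matrix has the entry
  \<open>block_sign n r\<close> at \<open>(r, opp n r)\<close>.\<close>

definition block_sign :: "nat \<Rightarrow> nat \<Rightarrow> complex" where
  "block_sign n r = (if r < n then 1 else -1)"

lemma opp_less [simp]: "r < 2 * n \<Longrightarrow> opp n r < 2 * n"
  unfolding opp_def by auto

lemma opp_opp [simp]: "r < 2 * n \<Longrightarrow> opp n (opp n r) = r"
  unfolding opp_def by auto

lemma block_sign_square [simp]: "block_sign n r * block_sign n r = 1"
  unfolding block_sign_def by auto

lemma block_sign_opp: "r < 2 * n \<Longrightarrow> block_sign n (opp n r) = - block_sign n r"
  unfolding block_sign_def opp_def by auto

text \<open>One rule replaces the four blocks: the sign product is 1 on the diagonal blocks, which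
  gives \<open>- antitranspose A\<close>, and -1 on the other two, which gives their antidiagonal
  symmetry.\<close>

lemma sp_iff:
  "x \<in> sp n \<longleftrightarrow> x \<in> carrier_mat (2 * n) (2 * n) \<and>
     (\<forall>r<2 * n. \<forall>c<2 * n. x $$ (r, c) =
        - (block_sign n r * block_sign n c * x $$ (opp n c, opp n r)))"
proof
  assume "x \<in> sp n"
  then obtain A M M' where x: "x = four_block_mat A M M' (- antitranspose A)"
    and c: "A \<in> carrier_mat n n" "M \<in> carrier_mat n n" "M' \<in> carrier_mat n n"
    and M: "M = antitranspose M" "M' = antitranspose M'"
    unfolding sp_def by blast
  have A': "antitranspose A \<in> carrier_mat n n" using c unfolding antitranspose_def by auto
  have Mi: "M $$ (i, j) = M $$ (n - 1 - j, n - 1 - i)"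
    "M' $$ (i, j) = M' $$ (n - 1 - j, n - 1 - i)" if "i < n" "j < n" for i j
  proof -
    have "antitranspose M $$ (i, j) = M $$ (n - 1 - j, n - 1 - i)"
      "antitranspose M' $$ (i, j) = M' $$ (n - 1 - j, n - 1 - i)"
      using that c unfolding antitranspose_def by auto
    thus "M $$ (i, j) = M $$ (n - 1 - j, n - 1 - i)"
      "M' $$ (i, j) = M' $$ (n - 1 - j, n - 1 - i)" using M by simp_all
  qed
  have Ai: "antitranspose A $$ (i, j) = A $$ (n - 1 - j, n - 1 - i)" if "i < n" "j < n" for i j
    using that c unfolding antitranspose_def by auto
  have xi: "x $$ (r, s) = (if r < n then if s < n then A $$ (r, s) else M $$ (r, s - n)
      else if s < n then M' $$ (r - n, s) else - A $$ (2 * n - 1 - s, 2 * n - 1 - r))"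
    if "r < 2 * n" "s < 2 * n" for r s
  proof -
    have "n - 1 - (s - n) = 2 * n - 1 - s" "n - 1 - (r - n) = 2 * n - 1 - r"
      if "\<not> r < n" "\<not> s < n" using that by auto
    thus ?thesis using that c A' Ai[of "r - n" "s - n"] unfolding x by auto
  qed
  have "x $$ (r, s) = - (block_sign n r * block_sign n s * x $$ (opp n s, opp n r))"
    if rs: "r < 2 * n" "s < 2 * n" for r s
  proof -
    have o: "opp n r < 2 * n" "opp n s < 2 * n" using rs by simp_all
    consider "r < n" "s < n" | "r < n" "\<not> s < n" | "\<not> r < n" "s < n" | "\<not> r < n" "\<not> s < n"
      by blast
    thus ?thesis
    proof cases
      case 2
      have "opp n s < n" "\<not> opp n r < n" "opp n r - n = n - 1 - r" "opp n s = n - 1 - (s - n)"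
        using 2 rs unfolding opp_def by auto
      thus ?thesis using 2 rs o Mi(1)[of r "s - n"] by (simp add: xi block_sign_def)
    next
      case 3
      have "\<not> opp n s < n" "opp n r < n" "opp n s - n = n - 1 - s" "opp n r = n - 1 - (r - n)"
        using 3 rs unfolding opp_def by auto
      thus ?thesis using 3 rs o Mi(2)[of "r - n" s] by (simp add: xi block_sign_def)
    qed (use rs o in \<open>auto simp: xi block_sign_def opp_def\<close>)
  qed
  moreover have "x \<in> carrier_mat (2 * n) (2 * n)"
    using c A' unfolding x mult_2 by (intro four_block_carrier_mat) auto
  ultimately show "x \<in> carrier_mat (2 * n) (2 * n) \<and> (\<forall>r<2 * n. \<forall>c<2 * n. x $$ (r, c) =
        - (block_sign n r * block_sign n c * x $$ (opp n c, opp n r)))" by blast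
next
  assume *: "x \<in> carrier_mat (2 * n) (2 * n) \<and> (\<forall>r<2 * n. \<forall>c<2 * n. x $$ (r, c) =
        - (block_sign n r * block_sign n c * x $$ (opp n c, opp n r)))"
  hence d: "dim_row x = 2 * n" "dim_col x = 2 * n" by auto
  have **: "x $$ (r, c) = - (block_sign n r * block_sign n c * x $$ (opp n c, opp n r))"
    if "r < 2 * n" "c < 2 * n" for r c using * that by blast
  define A M M' where "A = mat n n (\<lambda>(i, j). x $$ (i, j))"
    and "M = mat n n (\<lambda>(i, j). x $$ (i, j + n))" and "M' = mat n n (\<lambda>(i, j). x $$ (i + n, j))"
  have c: "A \<in> carrier_mat n n" "M \<in> carrier_mat n n" "M' \<in> carrier_mat n n"
    unfolding A_def M_def M'_def by auto
  have "M = antitranspose M"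
  proof (rule eq_matI)
    fix i j assume "i < dim_row (antitranspose M)" "j < dim_col (antitranspose M)"
    hence ij: "i < n" "j < n" using c unfolding antitranspose_def by auto
    have "opp n (j + n) = n - 1 - j" "opp n i = n - 1 - i + n" using ij unfolding opp_def by auto
    thus "M $$ (i, j) = antitranspose M $$ (i, j)"
      using ij **[of i "j + n"] unfolding antitranspose_def M_def by (auto simp: block_sign_def)
  qed (auto simp: antitranspose_def M_def)
  moreover have "M' = antitranspose M'"
  proof (rule eq_matI)
    fix i j assume "i < dim_row (antitranspose M')" "j < dim_col (antitranspose M')"
    hence ij: "i < n" "j < n" using c unfolding antitranspose_def by auto
    have "opp n (i + n) = n - 1 - i" "opp n j = n - 1 - j + n" using ij unfolding opp_def by auto
    thus "M' $$ (i, j) = antitranspose M' $$ (i, j)"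
      using ij **[of "i + n" j] unfolding antitranspose_def M'_def by (auto simp: block_sign_def)
  qed (auto simp: antitranspose_def M'_def)
  moreover have "x = four_block_mat A M M' (- antitranspose A)"
  proof (rule eq_matI)
    fix i j assume "i < dim_row (four_block_mat A M M' (- antitranspose A))"
      "j < dim_col (four_block_mat A M M' (- antitranspose A))"
    hence ij: "i < 2 * n" "j < 2 * n" using c unfolding antitranspose_def by auto
    have a: "(- antitranspose A) $$ (i - n, j - n) = - x $$ (opp n j, opp n i)"
      if "\<not> i < n" "\<not> j < n"
    proof -
      have "n - 1 - (j - n) = opp n j" "n - 1 - (i - n) = opp n i"
        using that ij unfolding opp_def by auto
      moreover have "i - n < n" "j - n < n" using that ij by auto
      ultimately show ?thesis unfolding antitranspose_def A_def by auto
    qed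
    have "dim_row (- antitranspose A) = n" "dim_col (- antitranspose A) = n"
      using c unfolding antitranspose_def by auto
    moreover have "dim_row A = n" "dim_col A = n" using c by auto
    ultimately show "x $$ (i, j) = four_block_mat A M M' (- antitranspose A) $$ (i, j)"
      using ij a **[OF ij] by (auto simp: A_def M_def M'_def block_sign_def)
  qed (use c d in \<open>auto simp: antitranspose_def\<close>)
  ultimately show "x \<in> sp n" using c unfolding sp_def by blast
qed

lemma sp_carrier: "x \<in> sp n \<Longrightarrow> x \<in> carrier_mat (2 * n) (2 * n)"
  unfolding sp_iff by blast

lemma sp_index:
  "x \<in> sp n \<Longrightarrow> r < 2 * n \<Longrightarrow> c < 2 * n \<Longrightarrow>
     x $$ (r, c) = - (block_sign n r * block_sign n c * x $$ (opp n c, opp n r))"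
  unfolding sp_iff by blast

lemma mat_subspace_sp: "mat_subspace (2 * n) (sp n)"
proof (rule mat_subspaceI)
  show "sp n \<subseteq> carrier_mat (2 * n) (2 * n)" using sp_carrier by blast
  show "0\<^sub>m (2 * n) (2 * n) \<in> sp n" unfolding sp_iff by auto
  fix x y assume xy: "x \<in> sp n" "y \<in> sp n"
  note c = sp_carrier[OF xy(1)] sp_carrier[OF xy(2)]
  show "x + y \<in> sp n" unfolding sp_iff
  proof (intro conjI allI impI)
    fix r s assume rs: "r < 2 * n" "s < 2 * n"
    thus "(x + y) $$ (r, s) =
        - (block_sign n r * block_sign n s * (x + y) $$ (opp n s, opp n r))"
      using c sp_index[OF xy(1) rs] sp_index[OF xy(2) rs] by (simp add: ring_distribs)
  qed (use c in auto)
next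
  fix a x assume x: "x \<in> sp n"
  note c = sp_carrier[OF x]
  show "a \<cdot>\<^sub>m x \<in> sp n" unfolding sp_iff
  proof (intro conjI allI impI)
    fix r s assume rs: "r < 2 * n" "s < 2 * n"
    thus "(a \<cdot>\<^sub>m x) $$ (r, s) =
        - (block_sign n r * block_sign n s * (a \<cdot>\<^sub>m x) $$ (opp n s, opp n r))"
      using c sp_index[OF x rs] by (simp add: mult.left_commute)
  qed (use c in auto)
qed

text \<open>Nilradicals and the corner are all cut out of \<open>sp n\<close> by a set of allowed
  positions, so closure under sums, scalars and (for transitive \<open>P\<close>) brackets is shown
  once.\<close>

definition supported :: "nat \<Rightarrow> (nat \<Rightarrow> nat \<Rightarrow> bool) \<Rightarrow> complex mat set" where
  "supported n P = {x \<in> sp n. \<forall>r<2 * n. \<forall>c<2 * n. x $$ (r, c) \<noteq> 0 \<longrightarrow> P r c}"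

lemma supported_sp: "x \<in> supported n P \<Longrightarrow> x \<in> sp n"
  unfolding supported_def by blast

lemma supported_index:
  "x \<in> supported n P \<Longrightarrow> r < 2 * n \<Longrightarrow> c < 2 * n \<Longrightarrow> \<not> P r c \<Longrightarrow> x $$ (r, c) = 0"
  unfolding supported_def by blast

lemma supportedI:
  "x \<in> sp n \<Longrightarrow> (\<And>r c. r < 2 * n \<Longrightarrow> c < 2 * n \<Longrightarrow> x $$ (r, c) \<noteq> 0 \<Longrightarrow> P r c) \<Longrightarrow> x \<in> supported n P"
  unfolding supported_def by blast

lemma mat_subspace_supported: "mat_subspace (2 * n) (supported n P)"
proof -
  note S = mat_subspaceD[OF mat_subspace_sp[of n]]
  show ?thesis
  proof (rule mat_subspaceI)
    show "supported n P \<subseteq> carrier_mat (2 * n) (2 * n)" using S(1) supported_sp by blast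
    show "0\<^sub>m (2 * n) (2 * n) \<in> supported n P" using S(2) by (intro supportedI) auto
    show "x + y \<in> supported n P" if xy: "x \<in> supported n P" "y \<in> supported n P" for x y
    proof (rule supportedI)
      show "x + y \<in> sp n" using xy S(3) supported_sp by blast
      have "x \<in> carrier_mat (2 * n) (2 * n)" "y \<in> carrier_mat (2 * n) (2 * n)"
        using xy S(1) supported_sp by blast+
      thus "P r c" if "r < 2 * n" "c < 2 * n" "(x + y) $$ (r, c) \<noteq> 0" for r c
        using that supported_index[OF xy(1), of r c] supported_index[OF xy(2), of r c] by (cases "P r c") auto
    qed
    show "a \<cdot>\<^sub>m x \<in> supported n P" if x: "x \<in> supported n P" for a x
    proof (rule supportedI)
      show "a \<cdot>\<^sub>m x \<in> sp n" using x S(4) supported_sp by blast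
      have "x \<in> carrier_mat (2 * n) (2 * n)" using x S(1) supported_sp by blast
      thus "P r c" if "r < 2 * n" "c < 2 * n" "(a \<cdot>\<^sub>m x) $$ (r, c) \<noteq> 0" for r c
        using that supported_index[OF x, of r c] by (cases "P r c") auto
    qed
  qed
qed

text \<open>An elementary matrix made compatible with \<open>sp n\<close> by its mirror image,
  without normalisation: on the antidiagonal, \<open>c = opp n r\<close>, the two terms coincide and
  the entry is 2.\<close>

definition root_vector :: "nat \<Rightarrow> nat \<Rightarrow> nat \<Rightarrow> complex mat" where
  "root_vector n r c = mat (2 * n) (2 * n) (\<lambda>(a, b). (if a = r \<and> b = c then 1 else 0)
     - block_sign n r * block_sign n c * (if a = opp n c \<and> b = opp n r then 1 else 0))"

lemma root_vector_carrier [simp]: "root_vector n r c \<in> carrier_mat (2 * n) (2 * n)"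
  unfolding root_vector_def by auto

lemma root_vector_index:
  "a < 2 * n \<Longrightarrow> b < 2 * n \<Longrightarrow> root_vector n r c $$ (a, b) = (if a = r \<and> b = c then 1 else 0)
     - block_sign n r * block_sign n c * (if a = opp n c \<and> b = opp n r then 1 else 0)"
  unfolding root_vector_def by auto

lemma root_vector_index_self:
  assumes "r < 2 * n" "c < 2 * n" shows "root_vector n r c $$ (r, c) \<noteq> 0"
proof -
  have "block_sign n r * block_sign n c = -1" if "r = opp n c"
    using that assms block_sign_opp[of c n] by simp
  thus ?thesis using assms by (cases "r = opp n c") (simp_all add: root_vector_index)
qed

lemma root_vector_in_sp:
  assumes "r < 2 * n" "c < 2 * n" shows "root_vector n r c \<in> sp n"
  unfolding sp_iff
proof (intro conjI allI impI)
  fix a b assume ab: "a < 2 * n" "b < 2 * n"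
  define s where "s = block_sign n r * block_sign n c"
  define t where "t = block_sign n a * block_sign n b"
  have ss: "s * s = 1" unfolding s_def by (metis block_sign_square mult.assoc mult.commute mult.right_neutral)
  define A B where "A \<longleftrightarrow> a = r \<and> b = c" and "B \<longleftrightarrow> a = opp n c \<and> b = opp n r"
  have e1: "root_vector n r c $$ (a, b) = (if A then 1 else 0) - s * (if B then 1 else 0)"
    unfolding root_vector_index[OF ab] A_def B_def s_def ..
  have "(opp n b = r \<and> opp n a = c) = B" "(opp n b = opp n c \<and> opp n a = opp n r) = A"
    using ab assms opp_opp unfolding A_def B_def by metis+
  hence e2: "root_vector n r c $$ (opp n b, opp n a) = (if B then 1 else 0) - s * (if A then 1 else 0)"
    using ab by (simp add: root_vector_index s_def)
  have ts: "t = s" if "A \<or> B"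
    using that assms unfolding s_def t_def A_def B_def by (auto simp: block_sign_opp)
  show "root_vector n r c $$ (a, b) =
      - (block_sign n a * block_sign n b * root_vector n r c $$ (opp n b, opp n a))"
    unfolding e1 e2 t_def[symmetric] using ss ts by (cases A; cases B) (simp_all add: algebra_simps)
qed simp

text \<open>Mirror positions span the same line, so later arguments may choose the more convenient
  one of the two.\<close>

lemma root_vector_opp:
  assumes "r < 2 * n" "c < 2 * n"
  shows "root_vector n (opp n c) (opp n r) = - (block_sign n r * block_sign n c) \<cdot>\<^sub>m root_vector n r c"
proof (rule eq_matI)
  have s: "block_sign n r = 1 \<or> block_sign n r = -1" "block_sign n c = 1 \<or> block_sign n c = -1"
    unfolding block_sign_def by auto
  fix a b assume "a < dim_row (- (block_sign n r * block_sign n c) \<cdot>\<^sub>m root_vector n r c)"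
    "b < dim_col (- (block_sign n r * block_sign n c) \<cdot>\<^sub>m root_vector n r c)"
  hence ab: "a < 2 * n" "b < 2 * n" by (auto simp: root_vector_def)
  have "dim_row (root_vector n r c) = 2 * n" "dim_col (root_vector n r c) = 2 * n"
    by (auto simp: root_vector_def)
  thus "root_vector n (opp n c) (opp n r) $$ (a, b) =
      (- (block_sign n r * block_sign n c) \<cdot>\<^sub>m root_vector n r c) $$ (a, b)"
    using ab assms s by (elim disjE) (simp_all add: root_vector_index block_sign_opp)
qed (auto simp: root_vector_def)

text \<open>The spanning principle used for every inclusion from below. In the sum over all
  positions each mirror pair is counted twice, and an antidiagonal position once but with a doubled
  root vector; hence the coefficients \<open>x $$ p / 2\<close>.\<close>

lemma sp_mem_subspace:
  assumes W: "mat_subspace (2 * n) W" and x: "x \<in> sp n"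
    and E: "\<And>r c. r < 2 * n \<Longrightarrow> c < 2 * n \<Longrightarrow> x $$ (r, c) \<noteq> 0 \<Longrightarrow> root_vector n r c \<in> W"
  shows "x \<in> W"
proof -
  let ?P = "{..<2 * n} \<times> {..<2 * n}"
  let ?f = "\<lambda>p. (x $$ p / 2) \<cdot>\<^sub>m root_vector n (fst p) (snd p)"
  let ?y = "finsum (mat_space (2 * n)) ?f ?P"
  have y: "?y \<in> W"
  proof (rule mat_finsum_closed[OF W])
    fix p assume p: "p \<in> ?P"
    show "?f p \<in> W"
    proof (cases "x $$ p = 0")
      case True
      have "?f p = 0\<^sub>m (2 * n) (2 * n)" unfolding True by (intro eq_matI) (auto simp: root_vector_def)
      thus ?thesis using mat_subspaceD(2)[OF W] by simp
    next
      case False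
      thus ?thesis using mat_subspaceD(4)[OF W] E[of "fst p" "snd p"] p by auto
    qed
  qed simp
  hence yc: "?y \<in> carrier_mat (2 * n) (2 * n)" using mat_subspaceD(1)[OF W] by blast
  have "x = ?y"
  proof (rule eq_matI)
    fix a b assume "a < dim_row ?y" "b < dim_col ?y"
    hence ab: "a < 2 * n" "b < 2 * n" using yc by auto
    have "?y $$ (a, b) = (\<Sum>p\<in>?P. ?f p $$ (a, b))"
      using ab by (intro index_mat_finsum) (auto simp: root_vector_def)
    also have "\<dots> = (\<Sum>p\<in>?P. (if p = (a, b) then x $$ p / 2 else 0)
        - (if p = (opp n b, opp n a) then block_sign n (fst p) * block_sign n (snd p) * (x $$ p / 2) else 0))"
    proof (rule sum.cong[OF refl])
      fix p assume p: "p \<in> ?P"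
      have "?f p $$ (a, b) = x $$ p / 2 * root_vector n (fst p) (snd p) $$ (a, b)"
        using ab by (simp add: root_vector_def)
      also have "\<dots> = (if p = (a, b) then x $$ p / 2 else 0)
        - (if p = (opp n b, opp n a) then block_sign n (fst p) * block_sign n (snd p) * (x $$ p / 2) else 0)"
      proof -
        obtain r c where p': "p = (r, c)" by (cases p)
        have "(a = opp n c) = (c = opp n a)" "(b = opp n r) = (r = opp n b)"
          using p p' ab by (auto simp: opp_def)
        hence "(a = opp n c \<and> b = opp n r) = ((r, c) = (opp n b, opp n a))" by blast
        moreover have "(a = r \<and> b = c) = ((r, c) = (a, b))" by blast
        moreover have "v * ((if A then 1 else 0) - s * (if B then 1 else 0)) =
            (if A then v else 0) - (if B then s * v else 0)" for A B and s v :: complex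
          by (simp add: algebra_simps)
        ultimately show ?thesis unfolding p' root_vector_index[OF ab] fst_conv snd_conv
          by (simp only:)
      qed
      finally show "?f p $$ (a, b) = (if p = (a, b) then x $$ p / 2 else 0)
        - (if p = (opp n b, opp n a) then block_sign n (fst p) * block_sign n (snd p) * (x $$ p / 2) else 0)" .
    qed
    also have "\<dots> = x $$ (a, b) / 2 - block_sign n (opp n b) * block_sign n (opp n a) *
        (x $$ (opp n b, opp n a) / 2)"
      using ab by (simp add: sum_subtractf)
    also have "\<dots> = x $$ (a, b)"
      using sp_index[OF x ab] ab by (simp add: block_sign_opp mult.commute[of "block_sign n b"])
    finally show "x $$ (a, b) = ?y $$ (a, b)" by simp
  qed (use yc sp_carrier[OF x] in auto)
  thus ?thesis using y by simp
qed

section \<open>Root spaces\<close>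

definition torus_entry :: "nat \<Rightarrow> nat \<Rightarrow> (nat \<Rightarrow> complex) \<Rightarrow> complex" where
  "torus_entry n r d = (if r < n then d r else - d (opp n r))"

text \<open>The weight of the standard basis vector with index \<open>r\<close>: a coordinate form
  in the upper half, the negative of the mirrored one in the lower half. The position
  \<open>(r, c)\<close> therefore has weight \<open>weight_diff n r c\<close>.\<close>

definition weight :: "nat \<Rightarrow> nat \<Rightarrow> complex vec" where
  "weight n r = vec n (\<lambda>i. torus_entry n r (\<lambda>j. if j = i then 1 else 0))"

definition pairing :: "nat \<Rightarrow> complex vec \<Rightarrow> (nat \<Rightarrow> complex) \<Rightarrow> complex" where
  "pairing n \<gamma> d = (\<Sum>i<n. \<gamma> $ i * d i)"

abbreviation weight_diff :: "nat \<Rightarrow> nat \<Rightarrow> nat \<Rightarrow> complex vec" where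
  "weight_diff n r c \<equiv> weight n r - weight n c"

lemma weight_carrier [simp]: "weight n r \<in> carrier_vec n"
  unfolding weight_def by auto

lemma pairing_diff:
  "a \<in> carrier_vec n \<Longrightarrow> b \<in> carrier_vec n \<Longrightarrow>
     pairing n (a - b) d = pairing n a d - pairing n b d"
  unfolding pairing_def by (auto simp: sum_subtractf algebra_simps intro!: sum.cong)

lemma pairing_weight:
  assumes "r < 2 * n" shows "pairing n (weight n r) d = torus_entry n r d"
proof -
  define q where "q = (if r < n then r else opp n r)"
  have q: "q < n" using assms unfolding q_def opp_def by auto
  have "pairing n (weight n r) d = (\<Sum>i<n. if i = q then torus_entry n r d else 0)"
    unfolding pairing_def using q
    by (intro sum.cong) (auto simp: weight_def torus_entry_def q_def)
  thus ?thesis using q by simp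
qed

lemma pairing_root:
  "r < 2 * n \<Longrightarrow> c < 2 * n \<Longrightarrow> pairing n (weight_diff n r c) d = torus_entry n r d - torus_entry n c d"
  by (simp add: pairing_diff pairing_weight)

text \<open>Bracketing with a diagonal matrix scales the entry at \<open>(r, c)\<close> by a
  difference of diagonal entries, so membership is a condition on single entries.\<close>

lemma root_space_iff:
  "x \<in> root_space n \<gamma> \<longleftrightarrow> x \<in> sp n \<and> (\<forall>d. \<forall>r<2 * n. \<forall>c<2 * n.
     (torus_entry n r d - torus_entry n c d) * x $$ (r, c) = pairing n \<gamma> d * x $$ (r, c))"
proof (cases "x \<in> sp n")
  case True
  note xc = sp_carrier[OF True]
  define H where "H = (\<lambda>d. mat_diag (2 * n) (\<lambda>i. if i < n then d i else - d (2 * n - 1 - i)) :: complex mat)"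
  have w: "weight_eval n \<gamma> (H d) = pairing n \<gamma> d" for d
    unfolding weight_eval_def pairing_def H_def mat_diag_def by (intro sum.cong) auto
  have "bracket (H d) x = weight_eval n \<gamma> (H d) \<cdot>\<^sub>m x \<longleftrightarrow> (\<forall>r<2 * n. \<forall>c<2 * n.
     (torus_entry n r d - torus_entry n c d) * x $$ (r, c) = pairing n \<gamma> d * x $$ (r, c))" for d
  proof -
    have "bracket (H d) x = mat (2 * n) (2 * n)
        (\<lambda>(r, c). (torus_entry n r d - torus_entry n c d) * x $$ (r, c))"
      unfolding bracket_def H_def mat_diag_mult_left[OF xc] mat_diag_mult_right[OF xc]
      by (intro eq_matI) (auto simp: torus_entry_def opp_def algebra_simps)
    thus ?thesis using xc unfolding w by (auto simp: mat_eq_iff)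
  qed
  moreover have "torus n = range H" unfolding torus_def H_def by blast
  ultimately show ?thesis using True unfolding root_space_def by auto
qed (simp add: root_space_def)

text \<open>Cancelling the nonzero entry identifies two linear forms on the torus; evaluating them
  at the coordinate vectors gives the components of \<open>\<gamma>\<close>.\<close>

lemma root_space_entry:
  assumes "x \<in> root_space n \<gamma>" "\<gamma> \<in> carrier_vec n" "r < 2 * n" "c < 2 * n" "x $$ (r, c) \<noteq> 0"
  shows "\<gamma> = weight_diff n r c"
proof -
  have *: "torus_entry n r d - torus_entry n c d = pairing n \<gamma> d" for d
    using assms unfolding root_space_iff by (metis mult_right_cancel)
  have "\<gamma> $ i = weight_diff n r c $ i" if "i < n" for i
  proof -
    have "pairing n \<gamma> (\<lambda>j. if j = i then 1 else 0) = \<gamma> $ i"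
      unfolding pairing_def using that by (simp add: if_distrib cong: if_cong)
    thus ?thesis using *[of "\<lambda>j. if j = i then 1 else 0"] that by (simp add: weight_def)
  qed
  thus ?thesis using assms(2) by (intro eq_vecI) (auto simp: weight_def)
qed

lemma root_vector_in_root_space:
  assumes "r < 2 * n" "c < 2 * n" shows "root_vector n r c \<in> root_space n (weight_diff n r c)"
proof -
  have o: "torus_entry n (opp n a) d = - torus_entry n a d" if "a < 2 * n" for a d
    using that unfolding torus_entry_def by (auto simp: opp_def)
  show ?thesis
    unfolding root_space_iff using assms
    by (auto simp: root_vector_in_sp root_vector_index pairing_root o)
qed

text \<open>The torus element with diagonal \<open>2n-1, 2n-3, ..., -(2n-1)\<close> takes the value
  \<open>2(c - r)\<close> on the root at \<open>(r, c)\<close>. So \<open>c - r\<close> is the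
  height, and a root cannot occur both above and below the diagonal.\<close>

lemma root_height:
  assumes "r < 2 * n" "c < 2 * n" "r' < 2 * n" "c' < 2 * n" "weight_diff n r c = weight_diff n r' c'"
  shows "int c - int r = int c' - int r'"
proof -
  have t: "torus_entry n a (\<lambda>i. 2 * of_nat n - 1 - 2 * of_nat i) = 2 * of_nat n - 1 - 2 * of_nat a"
    if "a < 2 * n" for a
    using that by (auto simp: torus_entry_def opp_def of_nat_diff)
  let ?d = "\<lambda>i. 2 * of_nat n - 1 - 2 * of_nat i :: complex"
  have "torus_entry n r ?d - torus_entry n c ?d = torus_entry n r' ?d - torus_entry n c' ?d"
    using arg_cong[OF assms(5), of "\<lambda>\<gamma>. pairing n \<gamma> ?d"]
    unfolding pairing_root[OF assms(1,2)] pairing_root[OF assms(3,4)] .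
  hence "2 * (of_nat c - of_nat r) = (2 * (of_nat c' - of_nat r') :: complex)"
    unfolding t[OF assms(1)] t[OF assms(2)] t[OF assms(3)] t[OF assms(4)]
    by (simp add: algebra_simps)
  hence "of_nat c - of_nat r = (of_nat c' - of_nat r' :: complex)"
    by (metis mult_cancel_left zero_neq_numeral)
  hence "(of_int (int c - int r) :: complex) = of_int (int c' - int r')" by simp
  thus ?thesis by (simp only: of_int_eq_iff)
qed

section \<open>Roots and nilradicals\<close>

lemma weight_diff_carrier [simp]: "weight_diff n r c \<in> carrier_vec n"
  unfolding weight_def by auto

lemma eps_eq_weight:
  assumes "1 \<le> i" "i \<le> n"
  shows "eps n i = weight n (i - 1)" "eps n i = - weight n (opp n (i - 1))"
proof -
  have "i - 1 < n" "\<not> opp n (i - 1) < n" "opp n (opp n (i - 1)) = i - 1"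
    using assms by (auto simp: opp_def)
  thus "eps n i = weight n (i - 1)" "eps n i = - weight n (opp n (i - 1))"
    unfolding eps_def weight_def torus_entry_def by (auto intro!: eq_vecI simp del: opp_opp)
qed

lemma eps_add_eq_weight_diff:
  assumes "1 \<le> i" "i \<le> n" "1 \<le> j" "j \<le> n"
  shows "eps n i + eps n j = weight_diff n (i - 1) (opp n (j - 1))"
proof -
  have "eps n j = - weight n (opp n (j - 1))" using assms by (intro eps_eq_weight)
  thus ?thesis using assms by (intro eq_vecI) (auto simp: eps_eq_weight(1) weight_def)
qed

lemma double_eps: "2 \<cdot>\<^sub>v eps n i = eps n i + eps n i"
  unfolding eps_def by (intro eq_vecI) auto

text \<open>Short and long simple roots sit alike on the superdiagonal, since \<open>n - 1\<close>
  and \<open>n\<close> are mirror indices.\<close>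

lemma simple_root_eq_weight_diff:
  assumes "1 \<le> m" "m \<le> n"
  shows "simple_root n m = weight_diff n (m - 1) m"
proof (cases "m < n")
  case True
  thus ?thesis using assms unfolding simple_root_def by (simp add: eps_eq_weight(1))
next
  case False
  hence m: "m = n" using assms by simp
  have "opp n (n - 1) = n" using assms m unfolding opp_def by auto
  hence "eps n n + eps n n = weight_diff n (n - 1) n"
    using eps_add_eq_weight_diff[of n n n] assms m by simp
  thus ?thesis using m unfolding simple_root_def double_eps by simp
qed

lemma weight_diff_Suc_simple:
  assumes "q + 1 < 2 * n"
  obtains m where "1 \<le> m" "m \<le> n" "weight_diff n q (q + 1) = simple_root n m"
proof (cases "q < n")
  case True
  thus ?thesis using that[of "q + 1"] simple_root_eq_weight_diff[of "q + 1" n] by simp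
next
  case False
  \<comment> \<open>The mirror image of \<open>(q, q + 1)\<close> is \<open>(m - 1, m)\<close>,
    which has the same weight.\<close>
  define m where "m = opp n q"
  have m: "1 \<le> m" "m \<le> n" "\<not> q + 1 < n" "m - 1 < n" "m < n" "opp n (q + 1) = m - 1"
    using False assms unfolding m_def opp_def by auto
  have "weight_diff n q (q + 1) = weight_diff n (m - 1) m"
    using False m unfolding weight_def torus_entry_def
    by (intro eq_vecI) (auto simp: m_def)
  thus ?thesis using that[of m] m simple_root_eq_weight_diff[of m n] by simp
qed

text \<open>The fundamental coweights, the last one doubled.\<close>

definition coweight :: "nat \<Rightarrow> nat \<Rightarrow> complex" where
  "coweight m i = (if i < m then 1 else 0)"

lemma torus_entry_coweight:
  assumes "1 \<le> m" "m \<le> n" "r < 2 * n"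
  shows "torus_entry n r (coweight m) = (if r < m then 1 else 0) - (if 2 * n - m \<le> r then 1 else 0)"
  using assms unfolding torus_entry_def coweight_def opp_def by auto

lemma pairing_simple_root_coweight:
  assumes "1 \<le> m" "m \<le> n" "1 \<le> j" "j \<le> n"
  shows "pairing n (simple_root n j) (coweight m) = (if j = m then if m = n then 2 else 1 else 0)"
proof -
  have "j - 1 < 2 * n" "j < 2 * n" using assms by auto
  thus ?thesis
    using assms by (auto simp: simple_root_eq_weight_diff pairing_root torus_entry_coweight)
qed

lemma inj_on_simple_root: "inj_on (simple_root n) {1..n}"
proof (rule inj_onI)
  fix i j assume ij: "i \<in> {1..n}" "j \<in> {1..n}" "simple_root n i = simple_root n j"
  have "pairing n (simple_root n i) (coweight i) \<noteq> 0"
    using ij(1) by (simp add: pairing_simple_root_coweight)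
  hence "pairing n (simple_root n j) (coweight i) \<noteq> 0" using ij(3) by simp
  thus "i = j" using ij(1,2) by (auto simp: pairing_simple_root_coweight split: if_splits)
qed

lemma simple_root_carrier [simp]: "simple_root n m \<in> carrier_vec n"
  unfolding simple_root_def eps_def by auto

abbreviation simple_combination :: "nat \<Rightarrow> (complex vec \<Rightarrow> int) \<Rightarrow> complex vec" where
  "simple_combination n a \<equiv>
     finsum_vec TYPE(complex) n (\<lambda>\<delta>. of_int (a \<delta>) \<cdot>\<^sub>v \<delta>) (simple_roots n)"

lemma simple_combination_carrier: "simple_combination n a \<in> carrier_vec n"
  by (rule finsum_vec_closed) (auto simp: simple_roots_def)

lemma index_simple_combination:
  assumes "i < n"
  shows "simple_combination n a $ i = (\<Sum>\<delta>\<in>simple_roots n. of_int (a \<delta>) * \<delta> $ i)"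
proof -
  have "simple_combination n a $ i = (\<Sum>\<delta>\<in>simple_roots n. (of_int (a \<delta>) \<cdot>\<^sub>v \<delta>) $ i)"
    by (rule index_finsum_vec) (use assms in \<open>auto simp: simple_roots_def\<close>)
  also have "\<dots> = (\<Sum>\<delta>\<in>simple_roots n. of_int (a \<delta>) * \<delta> $ i)"
  proof (rule sum.cong[OF refl])
    fix \<delta> assume "\<delta> \<in> simple_roots n"
    hence "\<delta> \<in> carrier_vec n" unfolding simple_roots_def by auto
    thus "(of_int (a \<delta>) \<cdot>\<^sub>v \<delta>) $ i = of_int (a \<delta>) * \<delta> $ i" using assms by auto
  qed
  finally show ?thesis .
qed

lemma pairing_simple_combination:
  assumes "1 \<le> m" "m \<le> n"
  shows "pairing n (simple_combination n a) (coweight m) =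
    of_int (a (simple_root n m)) * (if m = n then 2 else 1)"
proof -
  have "pairing n (simple_combination n a) (coweight m) =
      (\<Sum>i<n. \<Sum>\<delta>\<in>simple_roots n. of_int (a \<delta>) * (\<delta> $ i * coweight m i))"
    unfolding pairing_def
    by (intro sum.cong) (auto simp: index_simple_combination sum_distrib_right mult.assoc)
  also have "\<dots> = (\<Sum>\<delta>\<in>simple_roots n. of_int (a \<delta>) * pairing n \<delta> (coweight m))"
    unfolding pairing_def sum_distrib_left by (rule sum.swap)
  also have "\<dots> = (\<Sum>j\<in>{1..n}. of_int (a (simple_root n j)) * pairing n (simple_root n j) (coweight m))"
    unfolding simple_roots_def by (subst sum.reindex[OF inj_on_simple_root]) (simp add: o_def)
  also have "\<dots> = (\<Sum>j\<in>{1..n}. if j = m then of_int (a (simple_root n m)) * (if m = n then 2 else 1) else 0)"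
    using assms by (intro sum.cong) (auto simp: pairing_simple_root_coweight)
  also have "\<dots> = of_int (a (simple_root n m)) * (if m = n then 2 else 1)" using assms by simp
  finally show ?thesis .
qed

text \<open>Telescoping along a row: moving one column to the right adds the simple root of a
  superdiagonal position.\<close>

lemma weight_diff_combination:
  assumes "r \<le> c" "c < 2 * n"
  shows "\<exists>a. weight_diff n r c = simple_combination n a"
  using assms
proof (induction c rule: dec_induct)
  case base
  define a where "a = (\<lambda>_ :: complex vec. 0 :: int)"
  have "weight_diff n r r = simple_combination n a"
  proof (rule eq_vecI)
    fix i assume "i < dim_vec (simple_combination n a)"
    hence i: "i < n" using carrier_vecD[OF simple_combination_carrier[of n a]] by simp
    show "weight_diff n r r $ i = simple_combination n a $ i"
      unfolding index_simple_combination[OF i] using i by (simp add: a_def weight_def)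
  qed (use carrier_vecD[OF simple_combination_carrier[of n a]] in \<open>simp add: weight_def\<close>)
  thus ?case by blast
next
  case (step c)
  then obtain a where a: "weight_diff n r c = simple_combination n a" by auto
  obtain m where m: "1 \<le> m" "m \<le> n" "weight_diff n c (c + 1) = simple_root n m"
    using weight_diff_Suc_simple[of c n] step.prems by auto
  define b where "b = (\<lambda>\<delta>. a \<delta> + (if \<delta> = simple_root n m then 1 else 0))"
  have mem: "simple_root n m \<in> simple_roots n" using m unfolding simple_roots_def by auto
  have fin: "finite (simple_roots n)" unfolding simple_roots_def by auto
  have "weight_diff n r (Suc c) = simple_combination n b"
  proof (rule eq_vecI)
    fix i assume "i < dim_vec (simple_combination n b)"
    hence i: "i < n" using carrier_vecD[OF simple_combination_carrier[of n b]] by simp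
    have "simple_combination n b $ i = simple_combination n a $ i
        + (\<Sum>\<delta>\<in>simple_roots n. if \<delta> = simple_root n m then \<delta> $ i else 0)"
      unfolding index_simple_combination[OF i] sum.distrib[symmetric]
      by (intro sum.cong) (auto simp: b_def ring_distribs)
    also have "\<dots> = weight_diff n r c $ i + weight_diff n c (c + 1) $ i"
      using mem fin a m by simp
    also have "\<dots> = weight_diff n r (Suc c) $ i" using i by (simp add: weight_def)
    finally show "weight_diff n r (Suc c) $ i = simple_combination n b $ i" by simp
  qed (use carrier_vecD[OF simple_combination_carrier[of n b]] in \<open>simp add: weight_def\<close>)
  thus ?case by blast
qed

text \<open>The coweight reads the coefficient off any integral expansion, so the description in
  \<open>root_coeff\<close> has exactly one solution. The factor 2 belongs to the doubled last
  coweight.\<close>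

lemma root_coeff_weight_diff:
  assumes "r \<le> c" "c < 2 * n" "1 \<le> m" "m \<le> n"
  shows "of_int (root_coeff n (weight_diff n r c) (simple_root n m)) * (if m = n then 2 else 1) =
    torus_entry n r (coweight m) - torus_entry n c (coweight m)"
proof -
  obtain a where a: "weight_diff n r c = simple_combination n a"
    using weight_diff_combination[OF assms(1,2)] by blast
  have *: "of_int (b (simple_root n m)) * (if m = n then 2 else 1) =
      torus_entry n r (coweight m) - torus_entry n c (coweight m)"
    if "weight_diff n r c = simple_combination n b" for b
    using pairing_simple_combination[OF assms(3,4), of b] assms
    by (simp add: that[symmetric] pairing_root)
  have "root_coeff n (weight_diff n r c) (simple_root n m) = a (simple_root n m)"
    unfolding root_coeff_def
  proof (rule the_equality)
    show "\<exists>b. b (simple_root n m) = a (simple_root n m) \<and> weight_diff n r c = simple_combination n b"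
      using a by blast
    fix j assume "\<exists>b. b (simple_root n m) = j \<and> weight_diff n r c = simple_combination n b"
    then obtain b where b: "b (simple_root n m) = j" "weight_diff n r c = simple_combination n b"
      by blast
    have "(of_int (b (simple_root n m)) :: complex) = of_int (a (simple_root n m))"
      using trans[OF *[OF b(2)] *[OF a, symmetric]]
      by (subst (asm) mult_right_cancel) auto
    thus "j = a (simple_root n m)" using b(1) by simp
  qed
  thus ?thesis using *[OF a] by simp
qed

lemma root_coeff_pos_iff:
  assumes "r < c" "c < 2 * n" "1 \<le> m" "m \<le> n"
  shows "root_coeff n (weight_diff n r c) (simple_root n m) > 0 \<longleftrightarrow>
    r < m \<and> m \<le> c \<or> r < 2 * n - m \<and> 2 * n - m \<le> c"
proof -
  define j where "j = root_coeff n (weight_diff n r c) (simple_root n m)"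
  \<comment> \<open>The number of cuts, at \<open>m\<close> and at \<open>2 * n - m\<close>, that
    the position crosses. For \<open>m = n\<close> the cuts coincide, so \<open>a\<close> is 0 or 2
    and matches the factor 2 on the other side.\<close>
  define a :: int where "a = (if r < m \<and> m \<le> c then 1 else 0) +
    (if r < 2 * n - m \<and> 2 * n - m \<le> c then 1 else 0)"
  have "torus_entry n r (coweight m) - torus_entry n c (coweight m) = of_int a"
    using assms by (auto simp: torus_entry_coweight a_def)
  hence "(of_int j * (if m = n then 2 else 1) :: complex) = of_int a"
    using root_coeff_weight_diff[of r c n m] assms by (simp add: j_def)
  hence "(of_int (j * (if m = n then 2 else 1)) :: complex) = of_int a" by (simp split: if_splits)
  hence "j * (if m = n then 2 else 1) = a" by (simp only: of_int_eq_iff)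
  moreover have "a > 0 \<longleftrightarrow> r < m \<and> m \<le> c \<or> r < 2 * n - m \<and> 2 * n - m \<le> c"
    unfolding a_def by auto
  ultimately show ?thesis unfolding j_def by (auto split: if_splits)
qed

section \<open>Positive roots and nilradicals as sets of matrix positions\<close>

lemma root_vector_nonzero:
  "r < 2 * n \<Longrightarrow> c < 2 * n \<Longrightarrow> root_vector n r c \<noteq> 0\<^sub>m (2 * n) (2 * n)"
  using root_vector_index_self[of r n c] by auto

lemma root_space_sub_sp: "root_space n \<gamma> \<subseteq> sp n"
  unfolding root_space_def by blast

lemma weight_diff_in_roots:
  assumes "r < 2 * n" "c < 2 * n" "r \<noteq> c"
  shows "weight_diff n r c \<in> roots n"
proof -
  have "weight_diff n r c \<noteq> 0\<^sub>v n"
  proof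
    assume "weight_diff n r c = 0\<^sub>v n"
    hence "weight_diff n r c = weight_diff n r r" by (simp add: weight_def)
    from root_height[OF assms(1,2,1,1) this] show False using assms(3) by simp
  qed
  moreover have "root_space n (weight_diff n r c) \<noteq> {0\<^sub>m (2 * n) (2 * n)}"
    using root_vector_in_root_space[OF assms(1,2)] root_vector_nonzero[OF assms(1,2)] by auto
  ultimately show ?thesis unfolding roots_def by simp
qed

text \<open>All positions of a root have the same height, so one position above the diagonal already
  puts the whole root space into the Borel subalgebra.\<close>

lemma positive_roots_eq:
  "positive_roots n = {weight_diff n r c | r c. r < c \<and> c < 2 * n}"
proof (intro equalityI subsetI)
  fix \<gamma> assume "\<gamma> \<in> positive_roots n"
  hence \<gamma>: "\<gamma> \<in> carrier_vec n" "\<gamma> \<noteq> 0\<^sub>v n" "root_space n \<gamma> \<noteq> {0\<^sub>m (2 * n) (2 * n)}"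
    "root_space n \<gamma> \<subseteq> borel n" unfolding positive_roots_def roots_def by auto
  have "0\<^sub>m (2 * n) (2 * n) \<in> root_space n \<gamma>"
    unfolding root_space_iff using mat_subspaceD(2)[OF mat_subspace_sp[of n]] by auto
  then obtain x where x: "x \<in> root_space n \<gamma>" "x \<noteq> 0\<^sub>m (2 * n) (2 * n)" using \<gamma>(3) by blast
  have xc: "x \<in> carrier_mat (2 * n) (2 * n)" using x(1) root_space_sub_sp sp_carrier by blast
  have "\<exists>r c. r < 2 * n \<and> c < 2 * n \<and> x $$ (r, c) \<noteq> 0"
  proof (rule ccontr)
    assume "\<not> ?thesis"
    hence "x = 0\<^sub>m (2 * n) (2 * n)" using xc by (intro eq_matI) auto
    thus False using x(2) by simp
  qed
  then obtain r c where rc: "r < 2 * n" "c < 2 * n" "x $$ (r, c) \<noteq> 0" by blast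
  have eq: "\<gamma> = weight_diff n r c" using root_space_entry[OF x(1) \<gamma>(1) rc] .
  have "\<not> c < r"
  proof
    assume "c < r"
    moreover have "upper_triangular x" using x(1) \<gamma>(4) unfolding borel_def by blast
    ultimately have "x $$ (r, c) = 0" using rc(1) xc by auto
    thus False using rc(3) by simp
  qed
  moreover have "r \<noteq> c"
  proof
    assume "r = c"
    hence "\<gamma> = 0\<^sub>v n" using eq by (simp add: weight_def)
    thus False using \<gamma>(2) by simp
  qed
  ultimately have "r < c" by simp
  thus "\<gamma> \<in> {weight_diff n r c | r c. r < c \<and> c < 2 * n}" using eq rc by blast
next
  fix \<gamma> assume "\<gamma> \<in> {weight_diff n r c | r c. r < c \<and> c < 2 * n}"
  then obtain r c where rc: "\<gamma> = weight_diff n r c" "r < c" "c < 2 * n" by blast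
  have "root_space n \<gamma> \<subseteq> borel n"
  proof
    fix x assume x: "x \<in> root_space n \<gamma>"
    have xs: "x \<in> sp n" using x root_space_sub_sp by blast
    have "x $$ (a, b) = 0" if "a < 2 * n" "b < a" for a b
    proof (rule ccontr)
      assume "x $$ (a, b) \<noteq> 0"
      hence "weight_diff n r c = weight_diff n a b"
        using root_space_entry[OF x _ that(1), of b] that rc(1) by simp
      from root_height[OF _ rc(3) that(1) _ this] show False using rc that by auto
    qed
    thus "x \<in> borel n" using xs sp_carrier[OF xs] unfolding borel_def by auto
  qed
  thus "\<gamma> \<in> positive_roots n"
    using weight_diff_in_roots[of r n c] rc unfolding positive_roots_def by auto
qed

text \<open>The (0-based) matrix positions \<open>(r, c)\<close> strictly above the block diagonal whose blocks end
  after rows \<open>m\<close> and \<open>2 * n - m\<close>, \<open>m \<in> I\<close>.\<close>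

definition parabolic_pair :: "nat \<Rightarrow> nat set \<Rightarrow> nat \<Rightarrow> nat \<Rightarrow> bool" where
  "parabolic_pair n I r c \<longleftrightarrow> r < c \<and> (\<exists>m\<in>I. r < m \<and> m \<le> c \<or> r < 2 * n - m \<and> 2 * n - m \<le> c)"

lemma parabolic_pair_iff_root_coeff:
  assumes "I \<subseteq> {1..n}" "r < c" "c < 2 * n"
  shows "parabolic_pair n I r c \<longleftrightarrow>
    (\<exists>\<alpha>\<in>simple_root n ` I. root_coeff n (weight_diff n r c) \<alpha> > 0)"
proof -
  have "root_coeff n (weight_diff n r c) (simple_root n m) > 0 \<longleftrightarrow>
      r < m \<and> m \<le> c \<or> r < 2 * n - m \<and> 2 * n - m \<le> c" if "m \<in> I" for m
    using root_coeff_pos_iff[OF assms(2,3), of m] assms(1) that by auto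
  thus ?thesis using assms(2) unfolding parabolic_pair_def by auto
qed

text \<open>A root may occur at two mirror positions. They share the simple root coefficients, so
  the cut condition passes from one to the other, and the height gives \<open>a < b\<close>.\<close>

lemma root_space_sub_supported:
  assumes "I \<subseteq> {1..n}" "parabolic_pair n I r c" "c < 2 * n"
  shows "root_space n (weight_diff n r c) \<subseteq> supported n (parabolic_pair n I)"
proof
  fix x assume x: "x \<in> root_space n (weight_diff n r c)"
  have rc: "r < c" using assms(2) unfolding parabolic_pair_def by blast
  show "x \<in> supported n (parabolic_pair n I)"
  proof (rule supportedI)
    show "x \<in> sp n" using x root_space_sub_sp by blast
    fix a b assume ab: "a < 2 * n" "b < 2 * n" "x $$ (a, b) \<noteq> 0"
    have eq: "weight_diff n r c = weight_diff n a b" using root_space_entry[OF x _ ab] by simp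
    from root_height[OF _ assms(3) ab(1,2) eq] rc assms(3) have "a < b" by auto
    thus "parabolic_pair n I a b"
      using assms rc eq ab(2) parabolic_pair_iff_root_coeff[OF assms(1)] by metis
  qed
qed

lemma nilradical_eq_supported:
  assumes "I \<subseteq> {1..n}"
  shows "nilradical n (simple_root n ` I) = supported n (parabolic_pair n I)"
proof
  let ?R = "{\<gamma> \<in> positive_roots n. \<exists>\<alpha>\<in>simple_root n ` I. root_coeff n \<gamma> \<alpha> > 0}"
  have R: "?R = {weight_diff n r c | r c. parabolic_pair n I r c \<and> c < 2 * n}"
  proof (intro equalityI subsetI)
    fix \<gamma> assume "\<gamma> \<in> ?R"
    then obtain r c where "\<gamma> = weight_diff n r c" "r < c" "c < 2 * n"
      "\<exists>\<alpha>\<in>simple_root n ` I. root_coeff n \<gamma> \<alpha> > 0" unfolding positive_roots_eq by blast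
    thus "\<gamma> \<in> {weight_diff n r c | r c. parabolic_pair n I r c \<and> c < 2 * n}"
      using parabolic_pair_iff_root_coeff[OF assms] by blast
  next
    fix \<gamma> assume "\<gamma> \<in> {weight_diff n r c | r c. parabolic_pair n I r c \<and> c < 2 * n}"
    then obtain r c where rc: "\<gamma> = weight_diff n r c" "parabolic_pair n I r c" "c < 2 * n" by blast
    hence "r < c" unfolding parabolic_pair_def by blast
    thus "\<gamma> \<in> ?R"
      using rc parabolic_pair_iff_root_coeff[OF assms] unfolding positive_roots_eq by blast
  qed
  have "(\<Union>\<gamma>\<in>?R. root_space n \<gamma>) \<subseteq> supported n (parabolic_pair n I)"
    unfolding R using root_space_sub_supported[OF assms] by blast
  thus "nilradical n (simple_root n ` I) \<subseteq> supported n (parabolic_pair n I)"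
    unfolding nilradical_def subspaces_sum_def by (rule mat_span_least[OF _ mat_subspace_supported])
  have C: "(\<Union>\<gamma>\<in>?R. root_space n \<gamma>) \<subseteq> carrier_mat (2 * n) (2 * n)"
    using root_space_sub_sp sp_carrier by blast
  show "supported n (parabolic_pair n I) \<subseteq> nilradical n (simple_root n ` I)"
  proof
    fix x assume x: "x \<in> supported n (parabolic_pair n I)"
    show "x \<in> nilradical n (simple_root n ` I)"
      unfolding nilradical_def subspaces_sum_def
    proof (rule sp_mem_subspace[OF mat_subspace_span[OF C] supported_sp[OF x]])
      fix r c assume rc: "r < 2 * n" "c < 2 * n" "x $$ (r, c) \<noteq> 0"
      hence "parabolic_pair n I r c" using supported_index[OF x] by blast
      hence "weight_diff n r c \<in> ?R" unfolding R using rc by blast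
      moreover have "root_vector n r c \<in> root_space n (weight_diff n r c)"
        using root_vector_in_root_space rc by blast
      ultimately show "root_vector n r c \<in> mat_span (2 * n) (\<Union>\<gamma>\<in>?R. root_space n \<gamma>)"
        using mat_span_superset[OF C] by blast
    qed
  qed
qed

text \<open>The root sits on the antidiagonal at \<open>(i - 1, opp n (i - 1))\<close>, and this
  position crosses the cuts belonging to \<open>m\<close> exactly when
  \<open>i \<le> m\<close>.\<close>

lemma kostant_root_mem_iff:
  assumes "I \<subseteq> {1..n}" "1 \<le> i" "i \<le> n"
  shows "kostant_root n i \<in> roots_of n (supported n (parabolic_pair n I)) \<longleftrightarrow> (\<exists>m\<in>I. i \<le> m)"
proof -
  let ?r = "i - 1" and ?c = "opp n (i - 1)"
  have rc: "?r < 2 * n" "?c < 2 * n" "?r < ?c" using assms unfolding opp_def by auto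
  have k: "kostant_root n i = weight_diff n ?r ?c"
    using eps_add_eq_weight_diff[of i n i] assms unfolding kostant_root_def double_eps by simp
  have root: "kostant_root n i \<in> roots n" unfolding k using rc by (intro weight_diff_in_roots) auto
  have "root_space n (kostant_root n i) \<subseteq> supported n (parabolic_pair n I) \<longleftrightarrow> parabolic_pair n I ?r ?c"
  proof
    assume "root_space n (kostant_root n i) \<subseteq> supported n (parabolic_pair n I)"
    hence "root_vector n ?r ?c \<in> supported n (parabolic_pair n I)"
      using root_vector_in_root_space[OF rc(1,2)] unfolding k by blast
    thus "parabolic_pair n I ?r ?c"
      using supported_index rc(1,2) root_vector_index_self[OF rc(1,2)] by blast
  qed (use root_space_sub_supported[OF assms(1) _ rc(2)] k in simp)
  also have "parabolic_pair n I ?r ?c \<longleftrightarrow> (\<exists>m\<in>I. i \<le> m)"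
  proof
    assume "parabolic_pair n I ?r ?c"
    then obtain m where "m \<in> I" "?r < m \<and> m \<le> ?c \<or> ?r < 2 * n - m \<and> 2 * n - m \<le> ?c"
      unfolding parabolic_pair_def by blast
    moreover from this have "m \<le> n" using assms(1) by auto
    ultimately show "\<exists>m\<in>I. i \<le> m" using assms unfolding opp_def by (intro bexI[of _ m]) auto
  next
    assume "\<exists>m\<in>I. i \<le> m"
    then obtain m where m: "m \<in> I" "i \<le> m" by blast
    moreover from m have "m \<le> n" using assms(1) by auto
    ultimately have "?r < m" "m \<le> ?c" using assms unfolding opp_def by auto
    thus "parabolic_pair n I ?r ?c" using m(1) rc(3) unfolding parabolic_pair_def by blast
  qed
  finally show ?thesis using root unfolding roots_of_def by simp
qed

lemma inj_on_kostant_root: "inj_on (kostant_root n) {1..n}"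
proof (rule inj_onI)
  fix i j assume ij: "i \<in> {1..n}" "j \<in> {1..n}" "kostant_root n i = kostant_root n j"
  have "kostant_root n i $ (i - 1) = kostant_root n j $ (i - 1)" using ij(3) by simp
  thus "i = j" using ij(1,2) unfolding kostant_root_def eps_def by (auto split: if_splits)
qed

text \<open>The cascade detects the maximum of the index set and nothing else about it.\<close>

lemma is_nilradical_supported:
  assumes "is_nilradical n \<nn>" "1 \<le> k" "k \<le> n"
    and "kostant_cascade n \<inter> roots_of n \<nn> = kostant_root n ` {1..k}"
  obtains I where "I \<subseteq> {1..k}" "k \<in> I" "\<nn> = supported n (parabolic_pair n I)"
proof -
  obtain T where T: "T \<subseteq> simple_roots n" "\<nn> = nilradical n T"
    using assms(1) unfolding is_nilradical_def by blast
  define I where "I = {m\<in>{1..n}. simple_root n m \<in> T}"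
  have TI: "T = simple_root n ` I" using T(1) unfolding I_def simple_roots_def by auto
  have I: "I \<subseteq> {1..n}" unfolding I_def by blast
  have nn: "\<nn> = supported n (parabolic_pair n I)"
    using T(2) nilradical_eq_supported[OF I] TI by simp
  have *: "(\<exists>m\<in>I. i \<le> m) \<longleftrightarrow> i \<le> k" if "1 \<le> i" "i \<le> n" for i
  proof -
    have "(\<exists>m\<in>I. i \<le> m) \<longleftrightarrow> kostant_root n i \<in> kostant_root n ` {1..k}"
      using kostant_root_mem_iff[OF I that] that assms(4) unfolding nn kostant_cascade_def by auto
    also have "\<dots> \<longleftrightarrow> i \<in> {1..k}"
      using inj_on_image_mem_iff[OF inj_on_kostant_root, of i n "{1..k}"] that assms(3) by auto
    finally show ?thesis using that by simp
  qed
  have "I \<subseteq> {1..k}"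
  proof
    fix m assume "m \<in> I"
    hence "1 \<le> m" "m \<le> n" "\<exists>m'\<in>I. m \<le> m'" using I by auto
    thus "m \<in> {1..k}" using *[of m] by simp
  qed
  moreover have "k \<in> I"
  proof -
    obtain m where m: "m \<in> I" "k \<le> m" using *[of k] assms by auto
    with \<open>I \<subseteq> {1..k}\<close> have "m = k" by force
    thus ?thesis using m(1) by simp
  qed
  ultimately show ?thesis using that nn by blast
qed

section \<open>Brackets and coadjoint stabilisers\<close>

lemma bracket_carrier:
  "x \<in> carrier_mat N N \<Longrightarrow> y \<in> carrier_mat N N \<Longrightarrow> bracket x y \<in> carrier_mat N N"
  unfolding bracket_def by auto

lemma bracket_index:
  assumes "x \<in> carrier_mat N N" "y \<in> carrier_mat N N" "r < N" "c < N"
  shows "bracket x y $$ (r, c) = (\<Sum>l<N. x $$ (r, l) * y $$ (l, c) - y $$ (r, l) * x $$ (l, c))"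
  using assms unfolding bracket_def
  by (simp add: scalar_prod_def sum_subtractf atLeast0LessThan)

lemma bracket_linear_left:
  assumes "x \<in> carrier_mat N N" "y \<in> carrier_mat N N" "z \<in> carrier_mat N N"
  shows "bracket (x + y) z = bracket x z + bracket y z" "bracket (a \<cdot>\<^sub>m x) z = a \<cdot>\<^sub>m bracket x z"
proof -
  note c = bracket_carrier[OF assms(1,3)] bracket_carrier[OF assms(2,3)]
  have d: "dim_row x = N" "dim_col x = N" "dim_row y = N" "dim_col y = N" using assms by auto
  have cs: "x + y \<in> carrier_mat N N" "a \<cdot>\<^sub>m x \<in> carrier_mat N N" using assms by auto
  show "bracket (x + y) z = bracket x z + bracket y z"
  proof (rule eq_matI)
    fix r s assume "r < dim_row (bracket x z + bracket y z)" "s < dim_col (bracket x z + bracket y z)"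
    hence rs: "r < N" "s < N" using c by auto
    have "bracket (x + y) z $$ (r, s) = bracket x z $$ (r, s) + bracket y z $$ (r, s)"
      unfolding bracket_index[OF cs(1) assms(3) rs] bracket_index[OF assms(1,3) rs]
        bracket_index[OF assms(2,3) rs] sum.distrib[symmetric]
      using rs d by (intro sum.cong) (auto simp: algebra_simps)
    thus "bracket (x + y) z $$ (r, s) = (bracket x z + bracket y z) $$ (r, s)" using rs c by auto
  qed (use c bracket_carrier[OF cs(1) assms(3)] in auto)
  show "bracket (a \<cdot>\<^sub>m x) z = a \<cdot>\<^sub>m bracket x z"
  proof (rule eq_matI)
    fix r s assume "r < dim_row (a \<cdot>\<^sub>m bracket x z)" "s < dim_col (a \<cdot>\<^sub>m bracket x z)"
    hence rs: "r < N" "s < N" using c by auto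
    have "bracket (a \<cdot>\<^sub>m x) z $$ (r, s) = a * bracket x z $$ (r, s)"
      unfolding bracket_index[OF cs(2) assms(3) rs] bracket_index[OF assms(1,3) rs] sum_distrib_left
      using rs d by (intro sum.cong) (auto simp: algebra_simps)
    thus "bracket (a \<cdot>\<^sub>m x) z $$ (r, s) = (a \<cdot>\<^sub>m bracket x z) $$ (r, s)" using rs c by auto
  qed (use c bracket_carrier[OF cs(2) assms(3)] in auto)
qed

lemma bracket_swap:
  assumes "x \<in> carrier_mat N N" "y \<in> carrier_mat N N"
  shows "bracket y x = (-1) \<cdot>\<^sub>m bracket x y"
proof -
  have "x * y \<in> carrier_mat N N" "y * x \<in> carrier_mat N N" using assms by auto
  thus ?thesis using assms unfolding bracket_def by (intro eq_matI) auto
qed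

lemma sum_opp: "(\<Sum>l<2 * n. f (opp n l)) = (\<Sum>l<2 * n. f l)"
  by (rule sum.reindex_bij_witness[of _ "opp n" "opp n"]) auto

lemma sp_index_opp:
  assumes "x \<in> sp n" "r < 2 * n" "c < 2 * n"
  shows "x $$ (opp n c, opp n r) = - (block_sign n r * block_sign n c * x $$ (r, c))"
  using sp_index[OF assms(1), of "opp n c" "opp n r"] assms
  by (simp add: block_sign_opp mult.commute[of "block_sign n c"])

text \<open>Mirroring both factors and reversing the summation index exchanges the order of the
  products, which turns the commutator into its negative.\<close>

lemma bracket_in_sp:
  assumes x: "x \<in> sp n" and y: "y \<in> sp n" shows "bracket x y \<in> sp n"
  unfolding sp_iff
proof (intro conjI allI impI)
  note c = sp_carrier[OF x] sp_carrier[OF y]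
  show "bracket x y \<in> carrier_mat (2 * n) (2 * n)" using bracket_carrier c .
  fix r s assume rs: "r < 2 * n" "s < 2 * n"
  have o: "opp n r < 2 * n" "opp n s < 2 * n" using rs by simp_all
  let ?e = "block_sign n r * block_sign n s"
  have e: "?e * ?e = 1" unfolding block_sign_def by auto
  have "bracket x y $$ (opp n s, opp n r) = (\<Sum>l<2 * n. x $$ (opp n s, opp n l) * y $$ (opp n l, opp n r)
      - y $$ (opp n s, opp n l) * x $$ (opp n l, opp n r))"
    unfolding bracket_index[OF c o(2,1)] by (rule sum_opp[symmetric])
  also have "\<dots> = (\<Sum>l<2 * n. - ?e * (x $$ (r, l) * y $$ (l, s) - y $$ (r, l) * x $$ (l, s)))"
  proof (rule sum.cong[OF refl])
    fix l assume "l \<in> {..<2 * n}"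
    hence l: "l < 2 * n" by simp
    have "block_sign n l = 1 \<or> block_sign n l = -1" unfolding block_sign_def by auto
    thus "x $$ (opp n s, opp n l) * y $$ (opp n l, opp n r)
        - y $$ (opp n s, opp n l) * x $$ (opp n l, opp n r)
        = - ?e * (x $$ (r, l) * y $$ (l, s) - y $$ (r, l) * x $$ (l, s))"
      unfolding sp_index_opp[OF x l rs(2)] sp_index_opp[OF y l rs(2)]
        sp_index_opp[OF x rs(1) l] sp_index_opp[OF y rs(1) l]
      by (elim disjE) (simp_all add: algebra_simps)
  qed
  also have "\<dots> = - ?e * bracket x y $$ (r, s)"
    unfolding bracket_index[OF c rs] sum_distrib_left ..
  finally have "- (?e * bracket x y $$ (opp n s, opp n r)) = (?e * ?e) * bracket x y $$ (r, s)" by simp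
  thus "bracket x y $$ (r, s) = - (?e * bracket x y $$ (opp n s, opp n r))" unfolding e by simp
qed

lemma bracket_in_supported:
  assumes P: "\<And>r l c. P r l \<Longrightarrow> P l c \<Longrightarrow> P r c"
    and x: "x \<in> supported n P" and y: "y \<in> supported n P"
  shows "bracket x y \<in> supported n P"
proof (rule supportedI)
  note xs = supported_sp[OF x] and ys = supported_sp[OF y]
  show "bracket x y \<in> sp n" using bracket_in_sp[OF xs ys] .
  fix r c assume rc: "r < 2 * n" "c < 2 * n" "bracket x y $$ (r, c) \<noteq> 0"
  show "P r c"
  proof (rule ccontr)
    assume nP: "\<not> P r c"
    have "x $$ (r, l) * y $$ (l, c) - y $$ (r, l) * x $$ (l, c) = 0" if "l < 2 * n" for l
    proof (cases "P r l")
      case True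
      hence "\<not> P l c" using P nP by blast
      thus ?thesis using supported_index[OF x that rc(2)] supported_index[OF y that rc(2)] by simp
    next
      case False
      thus ?thesis using supported_index[OF x rc(1) that] supported_index[OF y rc(1) that] by simp
    qed
    hence "bracket x y $$ (r, c) = 0"
      unfolding bracket_index[OF sp_carrier[OF xs] sp_carrier[OF ys] rc(1,2)] by simp
    thus False using rc(3) by simp
  qed
qed

section \<open>Linear forms and coadjoint stabilisers\<close>

lemma dual_space_linear: "\<xi> \<in> dual_space \<qq> \<Longrightarrow> mat_linear \<qq> \<xi>"
  unfolding dual_space_def mat_linear_def by auto

lemma restrict_in_dual_space:
  assumes "mat_subspace N \<qq>" "mat_linear \<qq> f" shows "restrict f \<qq> \<in> dual_space \<qq>"
  using assms unfolding dual_space_def mat_linear_def mat_subspace_def by auto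

lemma mat_linear_bracket:
  assumes q: "mat_subspace N \<qq>" "\<And>x y. x \<in> \<qq> \<Longrightarrow> y \<in> \<qq> \<Longrightarrow> bracket x y \<in> \<qq>"
    and f: "mat_linear \<qq> f" and y: "y \<in> \<qq>"
  shows "mat_linear \<qq> (\<lambda>x. f (bracket x y))" "mat_linear \<qq> (\<lambda>x. f (bracket y x))"
proof -
  have c: "x \<in> carrier_mat N N" if "x \<in> \<qq>" for x using that mat_subspaceD(1)[OF q(1)] by blast
  show l: "mat_linear \<qq> (\<lambda>x. f (bracket x y))"
    unfolding mat_linear_def
    using bracket_linear_left[OF c c c] y mat_linearD(1)[OF f q(2) q(2)] mat_linearD(2)[OF f q(2)]
    by simp
  have "f (bracket y x) = - f (bracket x y)" if x: "x \<in> \<qq>" for x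
    using bracket_swap[OF c[OF x] c[OF y]] mat_linearD(2)[OF f q(2)[OF x y], of "-1"] by simp
  thus "mat_linear \<qq> (\<lambda>x. f (bracket y x))"
    using l mat_subspaceD(3,4)[OF q(1)] unfolding mat_linear_def by auto
qed

lemma mat_subspace_stabiliser:
  assumes "mat_subspace N \<qq>" "\<And>x y. x \<in> \<qq> \<Longrightarrow> y \<in> \<qq> \<Longrightarrow> bracket x y \<in> \<qq>"
    and "mat_linear \<qq> f"
  shows "mat_subspace N (stabiliser \<qq> f)"
  unfolding stabiliser_def
  using mat_linear_bracket(1)[OF assms] by (intro mat_subspace_kernels[OF assms(1)]) auto

section \<open>Symmetric forms adapted to the flag\<close>

text \<open>The matrix \<open>(1 - \<mu> E\<^bsub>ij\<^esub>)\<^sup>T (1 - \<mu> E\<^bsub>ij\<^esub>)\<close> with \<open>i < j\<close>; since the factor on the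
  right is upper unitriangular, the flag of coordinate subspaces is nondegenerate for this form.\<close>

definition gram :: "nat \<Rightarrow> nat \<Rightarrow> complex \<Rightarrow> nat \<Rightarrow> nat \<Rightarrow> complex" where
  "gram i j \<mu> a b = (if a = b then 1 else 0) - (if a = i \<and> b = j then \<mu> else 0)
     - (if a = j \<and> b = i then \<mu> else 0) + (if a = j \<and> b = j then \<mu>\<^sup>2 else 0)"

lemma gram_sym: "gram i j \<mu> a b = gram i j \<mu> b a"
  unfolding gram_def by auto

lemma sum_gram:
  assumes "a < k" "i < k" "j < k"
  shows "(\<Sum>b<k. gram i j \<mu> a b * z b) =
    z a - (if a = i then \<mu> * z j else 0) - (if a = j then \<mu> * z i else 0)
      + (if a = j then \<mu>\<^sup>2 * z j else 0)"
proof -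
  have "(\<Sum>b<k. gram i j \<mu> a b * z b) = (\<Sum>b<k. (if b = a then z a else 0)
      - (if b = j then (if a = i then \<mu> * z j else 0) else 0)
      - (if b = i then (if a = j then \<mu> * z i else 0) else 0)
      + (if b = j then (if a = j then \<mu>\<^sup>2 * z j else 0) else 0))"
    by (intro sum.cong) (auto simp: gram_def algebra_simps)
  thus ?thesis using assms by (simp add: sum.distrib sum_subtractf)
qed

text \<open>Only rows \<open>i\<close> and \<open>j\<close> differ from unit vectors: row
  \<open>i\<close> gives \<open>z i = \<mu> * z j\<close>, after which the multiples of
  \<open>\<mu>\<^sup>2\<close> in row \<open>j\<close> cancel. The alternative
  \<open>\<mu> = 0\<close> admits the identity form for any \<open>i\<close> and
  \<open>j\<close>.\<close>

lemma gram_injective: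
  assumes "i < k" "j < k" "\<mu> = 0 \<or> i < j" "\<And>a. a < k \<Longrightarrow> (\<Sum>b<k. gram i j \<mu> a b * z b) = 0" "b < k"
  shows "z b = 0"
proof -
  have h: "z a - (if a = i then \<mu> * z j else 0) - (if a = j then \<mu> * z i else 0)
      + (if a = j then \<mu>\<^sup>2 * z j else 0) = 0" if "a < k" for a
    using assms(4)[OF that] that assms(1,2) by (simp add: sum_gram)
  show ?thesis
  proof (cases "\<mu> = 0")
    case True
    thus ?thesis using h[OF assms(5)] by (simp cong: if_cong)
  next
    case False
    hence ij: "i < j" using assms(3) by simp
    have i: "z i = \<mu> * z j" using h[OF assms(1)] ij by simp
    have "z j = 0" using h[OF assms(2)] ij i by (simp add: power2_eq_square)
    thus ?thesis using h[OF assms(5)] i by (auto split: if_splits)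
  qed
qed

text \<open>Conjugation by \<open>g\<close> is carried out as elimination: first row
  \<open>j\<close> of \<open>u\<close> vanishes, then row \<open>i\<close>, and the equations for
  the other entries have no correction terms left.\<close>

lemma gram_skew_triangular:
  assumes ij: "i < k" "j < k" "\<mu> = 0 \<or> i < j"
    and u: "\<And>a b. a < k \<Longrightarrow> b < k \<Longrightarrow> b \<le> a \<Longrightarrow> u a b = 0"
    and skew: "\<And>a b. a < k \<Longrightarrow> b < k \<Longrightarrow>
      (\<Sum>m<k. gram i j \<mu> a m * u m b) + (\<Sum>m<k. gram i j \<mu> b m * u m a) = 0"
    and ab: "a < k" "b < k"
  shows "u a b = 0"
proof -
  have h: "u a b - (if a = i then \<mu> * u j b else 0) - (if a = j then \<mu> * u i b else 0)
      + (if a = j then \<mu>\<^sup>2 * u j b else 0) + (u b a - (if b = i then \<mu> * u j a else 0)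
      - (if b = j then \<mu> * u i a else 0) + (if b = j then \<mu>\<^sup>2 * u j a else 0)) = 0"
    if "a < k" "b < k" for a b
    using skew[OF that] that ij(1,2) by (simp add: sum_gram)
  show ?thesis
  proof (cases "\<mu> = 0 \<or> b \<le> a")
    case True
    thus ?thesis using h[OF ab] u ab by (cases "b \<le> a") (auto cong: if_cong)
  next
    case False
    hence ij': "i < j" and lt: "a < b" using ij(3) by auto
    \<comment> \<open>Beyond column \<open>j\<close> the terms with exchanged indices vanish by
      triangularity, so rows \<open>i\<close> and \<open>j\<close> form the system solved in
      \<open>gram_injective\<close>.\<close>
    have s0: "u i b = 0 \<and> u j b = 0" if b: "j < b" "b < k" for b
    proof -
      have "u i b = \<mu> * u j b" using h[OF ij(1) b(2)] ij ij' b u[of b i] by simp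
      moreover have "u j b - \<mu> * u i b + \<mu>\<^sup>2 * u j b = 0"
        using h[OF ij(2) b(2)] ij ij' b u[of b j] by simp
      ultimately show ?thesis by (simp add: power2_eq_square)
    qed
    have s2: "u j b = 0" if "b < k" for b
      using s0[of b] u[of j b] that ij by (cases "b \<le> j") auto
    have s1: "u i b = 0" if b: "i < b" "b \<noteq> j" "b < k" for b
      using h[OF ij(1) b(3)] ij ij' b u[of b i] s2[of b] s0[of b] by (cases "b < j") auto
    show ?thesis
    proof (cases "a = i")
      case True
      show ?thesis
      proof (cases "b = j")
        case True
        thus ?thesis using h[OF ab] \<open>a = i\<close> ij ij' u[of j i] u[of j j] u[of i i] by simp
      qed (use s1 lt ab True in auto)
    next
      case nai: False
      have "u i a = 0" if "b = j"
        using that lt s1[of a] u[of i a] nai ab ij by (cases "i < a") auto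
      thus ?thesis
        using h[OF ab] nai lt u[OF ab(2,1)] s2[OF ab(1)] s2[OF ab(2)]
        by (cases "a = j") (auto split: if_splits)
    qed
  qed
qed

text \<open>This makes a stabilising corner matrix depend only on its block diagonal entries. Rows
  other than \<open>i\<close> and \<open>j\<close> give \<open>t a b = 0\<close> at once. Row
  \<open>i\<close> reduces to \<open>t j b\<close>, which vanishes by elimination, by
  \<open>diag\<close>, or by symmetry from row \<open>b\<close>.\<close>

lemma gram_block_triangular:
  assumes ij: "i < k" "j < k" "\<mu> = 0 \<or> i < j"
    and P: "\<And>a b. P a b \<Longrightarrow> a < b" "\<And>a a' b. P a b \<Longrightarrow> a' \<le> a \<Longrightarrow> P a' b"
    and sym: "\<And>a b. a < k \<Longrightarrow> b < k \<Longrightarrow> t a b = t b a"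
    and diag: "\<And>a b. a < k \<Longrightarrow> b < k \<Longrightarrow> \<not> P a b \<Longrightarrow> \<not> P b a \<Longrightarrow> t a b = 0"
    and tri: "\<And>a b. a < k \<Longrightarrow> b < k \<Longrightarrow> P a b \<Longrightarrow> (\<Sum>m<k. gram i j \<mu> a m * t m b) = 0"
    and ab: "a < k" "b < k"
  shows "t a b = 0"
proof -
  have h: "t a b - (if a = i then \<mu> * t j b else 0) - (if a = j then \<mu> * t i b else 0)
      + (if a = j then \<mu>\<^sup>2 * t j b else 0) = 0" if "a < k" "b < k" "P a b" for a b
    using tri[OF that] that ij(1,2) by (simp add: sum_gram)
  have s1: "t a b = 0" if "a < k" "b < k" "P a b" "\<mu> = 0 \<or> a \<noteq> i \<and> a \<noteq> j" for a b
    using h[OF that(1-3)] that(4) by (auto split: if_splits)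
  have main: "t a b = 0" if ab: "a < k" "b < k" "P a b" for a b
  proof (cases "\<mu> = 0 \<or> a \<noteq> i \<and> a \<noteq> j")
    case False
    hence ij': "i < j" using ij(3) by simp
    have s2: "t j b = 0" if Pj: "P j b"
    proof -
      have "t i b = \<mu> * t j b" using h[OF ij(1) ab(2) P(2)[OF Pj]] ij' by simp
      thus ?thesis using h[OF ij(2) ab(2) Pj] ij' by (simp add: power2_eq_square)
    qed
    show ?thesis
    proof (cases "a = j")
      case False
      hence ai: "a = i" using \<open>\<not> (\<mu> = 0 \<or> a \<noteq> i \<and> a \<noteq> j)\<close> by blast
      have "t j b = 0"
      proof (cases "P j b \<or> \<not> P b j")
        case True
        thus ?thesis using s2 diag[of j b] ij ab by blast
      next
        \<comment> \<open>Here \<open>P b j\<close>, so \<open>b\<close> lies strictly between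
          \<open>i\<close> and \<open>j\<close>, and row \<open>b\<close> of the form is a unit
          vector.\<close>
        case False
        hence "b \<noteq> i" "b \<noteq> j" using P(1)[of a b] P(1)[of b j] ab(3) ai by auto
        thus ?thesis using s1[of b j] False sym[of j b] ij ab by simp
      qed
      thus ?thesis using h[OF ab] ai ij' by simp
    qed (use s2 ab in simp)
  qed (use s1 ab in blast)
  show ?thesis
    using main[of a b] main[of b a] sym[of a b] diag[of a b] ab by metis
qed

section \<open>The Frobenius semiradical of a nilradical\<close>

definition corner :: "nat \<Rightarrow> nat \<Rightarrow> complex mat set" where
  "corner n k = supported n (\<lambda>r c. r < k \<and> 2 * n - k \<le> c)"

text \<open>In the coordinates \<open>(b, opp n a)\<close> antidiagonal symmetry becomes ordinary
  symmetry, and the value is the trace of \<open>F\<close> times the corner block.\<close>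

definition corner_form :: "nat \<Rightarrow> nat \<Rightarrow> (nat \<Rightarrow> nat \<Rightarrow> complex) \<Rightarrow> complex mat \<Rightarrow> complex" where
  "corner_form n k F x = (\<Sum>a<k. \<Sum>b<k. F a b * x $$ (b, opp n a))"

text \<open>The matrix \<open>v v^T\<close> in the same coordinates.\<close>

definition corner_square :: "nat \<Rightarrow> nat \<Rightarrow> (nat \<Rightarrow> complex) \<Rightarrow> complex mat" where
  "corner_square n k v = mat (2 * n) (2 * n)
     (\<lambda>(r, c). if r < k \<and> 2 * n - k \<le> c then v r * v (opp n c) else 0)"

abbreviation (input) row_form :: "nat \<Rightarrow> (nat \<Rightarrow> nat \<Rightarrow> complex) \<Rightarrow> complex mat \<Rightarrow> nat \<Rightarrow> nat \<Rightarrow> complex" where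
  "row_form k F x a l \<equiv> (\<Sum>b<k. F a b * x $$ (b, l))"

text \<open>For elements of \<open>sp n\<close> the corner block of \<open>- y * x\<close> is the
  transpose of that of \<open>x * y\<close>, so a symmetric \<open>F\<close> sees
  \<open>x * y\<close> twice.\<close>

lemma corner_form_bracket:
  assumes k: "k \<le> n" and F: "\<And>a b. F a b = F b a" and x: "x \<in> sp n" and y: "y \<in> sp n"
  shows "corner_form n k F (bracket x y) =
    2 * (\<Sum>a<k. \<Sum>l<2 * n. row_form k F x a l * y $$ (l, opp n a))"
proof -
  note c = sp_carrier[OF x] sp_carrier[OF y]
  have br: "bracket x y $$ (b, opp n a) =
      (\<Sum>l<2 * n. x $$ (b, l) * y $$ (l, opp n a)) + (\<Sum>l<2 * n. x $$ (a, l) * y $$ (l, opp n b))"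
    if ab: "a < k" "b < k" for a b
  proof -
    have a: "a < 2 * n" "b < 2 * n" "opp n a < 2 * n" "a < n" "b < n" "\<not> opp n a < n"
      using ab k by (auto simp: opp_def)
    have sgn: "block_sign n a = 1" "block_sign n b = 1" using a unfolding block_sign_def by auto
    have "- (y $$ (b, opp n l) * x $$ (opp n l, opp n a)) = x $$ (a, l) * y $$ (l, opp n b)"
      if l: "l < 2 * n" for l
    proof -
      have "block_sign n l = 1 \<or> block_sign n l = -1" unfolding block_sign_def by auto
      moreover have "x $$ (opp n l, opp n a) = - (block_sign n l * x $$ (a, l))"
        using sp_index_opp[OF x a(1) l] sgn by simp
      moreover have "y $$ (b, opp n l) = block_sign n l * y $$ (l, opp n b)"
        using sp_index_opp[OF y l, of "opp n b"] a sgn by (simp add: block_sign_opp)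
      ultimately show ?thesis by auto
    qed
    hence "(\<Sum>l<2 * n. - (y $$ (b, opp n l) * x $$ (opp n l, opp n a))) =
        (\<Sum>l<2 * n. x $$ (a, l) * y $$ (l, opp n b))" by (intro sum.cong) auto
    moreover have "(\<Sum>l<2 * n. - (y $$ (b, opp n l) * x $$ (opp n l, opp n a))) =
        (\<Sum>l<2 * n. - (y $$ (b, l) * x $$ (l, opp n a)))"
      by (rule sum_opp[where f = "\<lambda>l. - (y $$ (b, l) * x $$ (l, opp n a))"])
    ultimately show ?thesis
      unfolding bracket_index[OF c a(2,3)] by (simp add: sum_subtractf sum_negf)
  qed
  let ?g = "\<lambda>a b. \<Sum>l<2 * n. F a b * (x $$ (b, l) * y $$ (l, opp n a))"
  have "corner_form n k F (bracket x y) = (\<Sum>a<k. \<Sum>b<k. ?g a b + ?g b a)"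
    unfolding corner_form_def
  proof (intro sum.cong refl)
    fix a b assume "a \<in> {..<k}" "b \<in> {..<k}"
    thus "F a b * bracket x y $$ (b, opp n a) = ?g a b + ?g b a"
      using br[of a b] F[of b a] by (simp add: ring_distribs sum_distrib_left)
  qed
  also have "\<dots> = (\<Sum>a<k. \<Sum>b<k. ?g a b) + (\<Sum>a<k. \<Sum>b<k. ?g b a)" by (simp add: sum.distrib)
  also have "(\<Sum>a<k. \<Sum>b<k. ?g b a) = (\<Sum>a<k. \<Sum>b<k. ?g a b)" by (rule sum.swap)
  also have "(\<Sum>a<k. \<Sum>b<k. ?g a b) = (\<Sum>a<k. \<Sum>l<2 * n. row_form k F x a l * y $$ (l, opp n a))"
    unfolding sum_distrib_right mult.assoc by (rule sum.cong[OF refl], rule sum.swap)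
  finally show ?thesis by simp
qed

lemma card_pairs: "card {(i, j). i \<le> j \<and> j < k} = k * (k + 1) div 2" for k :: nat
proof -
  have "{(i, j). i \<le> j \<and> j < k} = (\<lambda>(j, i). (i, j)) ` (SIGMA j:{..<k}. {..j})" by auto
  moreover have "inj_on (\<lambda>(j, i). (i, j)) (SIGMA j:{..<k}. {..j})" by (auto simp: inj_on_def)
  ultimately have "card {(i, j). i \<le> j \<and> j < k} = (\<Sum>j<k. Suc j)" by (simp add: card_image)
  also have "\<dots> = k * (k + 1) div 2" by (induction k) auto
  finally show ?thesis .
qed

lemma corner_index_zero:
  assumes x: "x \<in> corner n k" and k: "k \<le> n"
    and z: "\<And>i j. i \<le> j \<Longrightarrow> j < k \<Longrightarrow> x $$ (i, opp n j) = 0"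
  shows "x = 0\<^sub>m (2 * n) (2 * n)"
proof -
  have xs: "x \<in> sp n" using x supported_sp unfolding corner_def by blast
  show ?thesis
  proof (rule eq_matI)
    fix r c assume "r < dim_row (0\<^sub>m (2 * n) (2 * n))" "c < dim_col (0\<^sub>m (2 * n) (2 * n))"
    hence rc: "r < 2 * n" "c < 2 * n" by auto
    have "x $$ (r, c) = 0"
    proof (cases "r < k \<and> 2 * n - k \<le> c")
      case True
      hence o: "opp n c < k" "opp n (opp n c) = c" using rc by (auto simp: opp_def)
      show ?thesis
      proof (cases "r \<le> opp n c")
        case True
        thus ?thesis using z[OF True o(1)] o by simp
      next
        case False
        hence "x $$ (opp n c, opp n r) = 0" using z[of "opp n c" r] \<open>r < k \<and> _\<close> by simp
        thus ?thesis using sp_index[OF xs rc] by simp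
      qed
    next
      case False
      thus ?thesis using supported_index[OF x[unfolded corner_def] rc] by blast
    qed
    thus "x $$ (r, c) = 0\<^sub>m (2 * n) (2 * n) $$ (r, c)" using rc by simp
  qed (use sp_carrier[OF xs] in auto)
qed

lemma mat_linear_index:
  "W \<subseteq> carrier_mat N N \<Longrightarrow> r < N \<Longrightarrow> c < N \<Longrightarrow> mat_linear W (\<lambda>x. x $$ (r, c))"
proof -
  assume W: "W \<subseteq> carrier_mat N N" and rc: "r < N" "c < N"
  have "dim_row x = N" "dim_col x = N" if "x \<in> W" for x using that W by auto
  thus ?thesis unfolding mat_linear_def using rc by simp
qed

lemma mat_subspace_corner: "mat_subspace (2 * n) (corner n k)"
  unfolding corner_def by (rule mat_subspace_supported)

lemma root_vector_in_supported:
  assumes "r < 2 * n" "c < 2 * n" "P r c" "P (opp n c) (opp n r)"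
  shows "root_vector n r c \<in> supported n P"
  using assms by (intro supportedI root_vector_in_sp) (auto simp: root_vector_index split: if_splits)

lemma root_vector_in_corner:
  assumes "k \<le> n" "i < k" "j < k"
  shows "root_vector n i (opp n j) \<in> corner n k"
  unfolding corner_def using assms by (intro root_vector_in_supported) (auto simp: opp_def)

lemma mat_dim_corner:
  assumes k: "k \<le> n" shows "mat_dim (2 * n) (corner n k) = k * (k + 1) div 2"
proof -
  let ?Q = "{(i, j). i \<le> j \<and> j < k}"
  let ?f = "\<lambda>(i, j) x. x $$ (i, opp n j) :: complex"
  have fin: "finite ?Q" by (rule finite_subset[of _ "{..<k} \<times> {..<k}"]) auto
  note S = mat_subspace_corner[of n k]
  have lin: "mat_linear (corner n k) (?f p)" if "p \<in> ?Q" for p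
    using that k mat_subspaceD(1)[OF S]
    by (cases p) (auto intro!: mat_linear_index[of _ "2 * n"])
  have ker: "{x \<in> corner n k. \<forall>p\<in>?Q. ?f p x = 0} = {0\<^sub>m (2 * n) (2 * n)}"
  proof (intro equalityI subsetI)
    fix x assume x: "x \<in> {x \<in> corner n k. \<forall>p\<in>?Q. ?f p x = 0}"
    hence "x = 0\<^sub>m (2 * n) (2 * n)"
      by (intro corner_index_zero[OF _ k]) auto
    thus "x \<in> {0\<^sub>m (2 * n) (2 * n)}" by simp
  qed (use mat_subspaceD(2)[OF S] k in auto)
  have "mat_dim (2 * n) (corner n k) \<le> card ?Q"
    using mat_dim_kernels[where P = ?Q and f = ?f, OF fin S lin] mat_dim_zero[of "2 * n"]
    unfolding ker by simp
  moreover have "card ?Q \<le> mat_dim (2 * n) (corner n k)"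
  proof (rule mat_dim_ge_card[where f = ?f and e = "\<lambda>(i, j). root_vector n i (opp n j)", OF fin S lin])
    let ?e = "\<lambda>(i, j). root_vector n i (opp n j)"
    \<comment> \<open>The second summand comes from the mirror entry. For ordered pairs it occurs
      only if \<open>p = q\<close> is diagonal, where the value becomes 2.\<close>
    have e: "?f p (?e q) = (if p = q then 1 else 0) + (if fst p = snd q \<and> snd p = fst q then 1 else 0)"
      if pq: "p \<in> ?Q" "q \<in> ?Q" for p q
    proof -
      obtain i j i' j' where ij: "p = (i, j)" "q = (i', j')" by (cases p; cases q)
      have b: "i < n" "j < n" "i' < n" "j' < n" using pq ij k by auto
      hence "(opp n j = opp n j') = (j = j')" "(opp n j = opp n i') = (j = i')"
        "opp n (opp n j') = j'" "block_sign n i' * block_sign n (opp n j') = -1"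
        by (auto simp: opp_def block_sign_def)
      thus ?thesis using b unfolding ij by (simp add: root_vector_index)
    qed
    show "?e p \<in> corner n k" if "p \<in> ?Q" for p
      using that k by (cases p) (auto intro!: root_vector_in_corner)
    show "?f p (?e p) \<noteq> 0" if "p \<in> ?Q" for p
      using e[OF that that] by (auto split: if_splits)
    show "?f p (?e q) = 0" if "p \<in> ?Q" "q \<in> ?Q" "p \<noteq> q" for p q
      using e[OF that(1,2)] that by (auto split: if_splits)
  qed
  ultimately show ?thesis using card_pairs[of k] by simp
qed

section \<open>The nilradical whose index set has maximum \<open>k\<close>\<close>

locale cascade_nilradical =
  fixes n k :: nat and I :: "nat set"
  assumes kn: "k \<le> n" and I: "I \<subseteq> {1..k}" and kI: "k \<in> I"
begin

abbreviation P :: "nat \<Rightarrow> nat \<Rightarrow> bool" where "P \<equiv> parabolic_pair n I"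
abbreviation \<qq> :: "complex mat set" where "\<qq> \<equiv> supported n P"

lemma I_bounds: "m \<in> I \<Longrightarrow> 1 \<le> m \<and> m \<le> k"
  using I by auto

lemma P_less: "P r c \<Longrightarrow> r < c"
  unfolding parabolic_pair_def by blast

lemma P_trans: "P r l \<Longrightarrow> P l c \<Longrightarrow> P r c"
  unfolding parabolic_pair_def by (meson less_trans less_imp_le le_trans)

lemma P_mono: "P r c \<Longrightarrow> r' \<le> r \<Longrightarrow> P r' c"
  unfolding parabolic_pair_def by (meson le_less_trans)

text \<open>The cuts at \<open>m\<close> and \<open>2 * n - m\<close> are exchanged by the
  reflection. A root vector occupies both mirror positions, so this is what places it in the
  nilradical.\<close>

lemma P_opp:
  assumes "r < 2 * n" "c < 2 * n" "P r c" shows "P (opp n c) (opp n r)"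
proof -
  obtain m where m: "m \<in> I" "r < m \<and> m \<le> c \<or> r < 2 * n - m \<and> 2 * n - m \<le> c"
    using assms(3) unfolding parabolic_pair_def by blast
  have "m \<le> n" using I_bounds[OF m(1)] kn by simp
  hence "opp n c < m \<and> m \<le> opp n r \<or> opp n c < 2 * n - m \<and> 2 * n - m \<le> opp n r"
    using m(2) assms(1,2) unfolding opp_def by auto
  moreover have "opp n c < opp n r" using P_less[OF assms(3)] assms(1,2) unfolding opp_def by auto
  ultimately show ?thesis using m(1) unfolding parabolic_pair_def by blast
qed

lemma P_cross: "r < k \<Longrightarrow> k \<le> c \<Longrightarrow> P r c"
  using kI unfolding parabolic_pair_def by auto

text \<open>No cut lies strictly between \<open>k\<close> and \<open>2 * n - k\<close>, so the
  middle square belongs to the Levi part.\<close>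

lemma P_middle: "k \<le> r \<Longrightarrow> c < 2 * n - k \<Longrightarrow> \<not> P r c"
proof
  assume rc: "k \<le> r" "c < 2 * n - k" and "P r c"
  then obtain m where m: "m \<in> I" "r < m \<and> m \<le> c \<or> r < 2 * n - m \<and> 2 * n - m \<le> c"
    unfolding parabolic_pair_def by blast
  thus False using I_bounds[OF m(1)] rc by auto
qed

lemma root_vector_in_q: "r < 2 * n \<Longrightarrow> c < 2 * n \<Longrightarrow> P r c \<Longrightarrow> root_vector n r c \<in> \<qq>"
  using root_vector_in_supported P_opp by blast

lemma mat_subspace_q: "mat_subspace (2 * n) \<qq>"
  by (rule mat_subspace_supported)

lemma bracket_q: "x \<in> \<qq> \<Longrightarrow> y \<in> \<qq> \<Longrightarrow> bracket x y \<in> \<qq>"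
  by (rule bracket_in_supported[OF P_trans])

lemma corner_subset_q: "corner n k \<subseteq> \<qq>"
proof
  fix x assume x: "x \<in> corner n k"
  show "x \<in> \<qq>"
  proof (rule supportedI)
    show "x \<in> sp n" using x supported_sp unfolding corner_def by blast
    fix r c assume "r < 2 * n" "c < 2 * n" "x $$ (r, c) \<noteq> 0"
    hence "r < k" "2 * n - k \<le> c" using supported_index[OF x[unfolded corner_def]] by blast+
    thus "P r c" using P_cross kn by auto
  qed
qed

text \<open>These are the \<open>a\<close> and \<open>s\<close> positions. A corner matrix has its
  columns among the last \<open>k\<close> and its rows among the first \<open>k\<close>; the root
  vector has no row among the last \<open>k\<close> and no column among the first \<open>k\<close>,
  so both products vanish.\<close>

lemma bracket_corner_root_vector:
  assumes t: "t \<in> corner n k" and rc: "r < 2 * n - k" "k \<le> c" "c < 2 * n"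
  shows "bracket t (root_vector n r c) = 0\<^sub>m (2 * n) (2 * n)"
proof -
  have r: "r < 2 * n" using rc by simp
  note ts = supported_index[OF t[unfolded corner_def]]
  have tc: "t \<in> carrier_mat (2 * n) (2 * n)"
    using t mat_subspaceD(1)[OF mat_subspace_corner] by blast
  note b = bracket_carrier[OF tc root_vector_carrier]
  show ?thesis
  proof (rule eq_matI)
    fix a d assume "a < dim_row (0\<^sub>m (2 * n) (2 * n))" "d < dim_col (0\<^sub>m (2 * n) (2 * n))"
    hence ad: "a < 2 * n" "d < 2 * n" by auto
    have "t $$ (a, l) * root_vector n r c $$ (l, d) = 0" if l: "l < 2 * n" for l
    proof (cases "2 * n - k \<le> l")
      case True
      hence "l \<noteq> r" "l \<noteq> opp n c" using rc unfolding opp_def by auto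
      thus ?thesis by (simp add: root_vector_index[OF l ad(2)])
    qed (use ts[OF ad(1) l] in simp)
    moreover have "root_vector n r c $$ (a, l) * t $$ (l, d) = 0" if l: "l < 2 * n" for l
    proof (cases "l < k")
      case True
      hence "l \<noteq> c" "l \<noteq> opp n r" using rc unfolding opp_def by auto
      thus ?thesis by (simp add: root_vector_index[OF ad(1) l])
    qed (use ts[OF l ad(2)] in simp)
    ultimately have "bracket t (root_vector n r c) $$ (a, d) = (\<Sum>l<2 * n. 0 - 0)"
      unfolding bracket_index[OF tc root_vector_carrier ad]
      by (intro sum.cong refl arg_cong2[where f = minus]) (simp_all only: lessThan_iff)
    thus "bracket t (root_vector n r c) $$ (a, d) = 0\<^sub>m (2 * n) (2 * n) $$ (a, d)"
      using ad by simp
  qed (use b in auto)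
qed

section \<open>The lower bound for every stabiliser\<close>

definition unipotent_pairs :: "(nat \<times> nat) set" where
  "unipotent_pairs = {(i, j). i \<le> j \<and> j < k \<and> P i j}"

text \<open>The corner coordinates in the diagonal blocks. Their number is \<open>k(k+1)/2\<close>
  minus the number of coordinates of \<open>u\<close>, which turns out to be the minimal stabiliser
  dimension.\<close>

definition block_pairs :: "(nat \<times> nat) set" where
  "block_pairs = {(i, j). i \<le> j \<and> j < k \<and> \<not> P i j}"

lemma finite_pairs: "finite unipotent_pairs" "finite block_pairs"
  by (rule finite_subset[of _ "{..<k} \<times> {..<k}"];
      auto simp: unipotent_pairs_def block_pairs_def)+

lemma mat_dim_corner_pairs:
  "mat_dim (2 * n) (corner n k) = card unipotent_pairs + card block_pairs"
proof -
  have "{(i, j). i \<le> j \<and> j < k} = unipotent_pairs \<union> block_pairs"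
    unfolding unipotent_pairs_def block_pairs_def by auto
  moreover have "unipotent_pairs \<inter> block_pairs = {}"
    unfolding unipotent_pairs_def block_pairs_def by auto
  ultimately show ?thesis
    using mat_dim_corner[OF kn] card_pairs[of k] finite_pairs by (simp add: card_Un_disjoint)
qed

lemma card_block_pairs_le:
  assumes \<eta>: "\<eta> \<in> dual_space \<qq>"
  shows "card block_pairs \<le> mat_dim (2 * n) (stabiliser \<qq> \<eta> \<inter> corner n k)"
proof -
  note lin = dual_space_linear[OF \<eta>]
  note S = mat_subspace_corner[of n k]
  let ?f = "\<lambda>p x. \<eta> (bracket x (root_vector n (fst p) (snd p)))"
  let ?K = "{x \<in> corner n k. \<forall>p\<in>unipotent_pairs. ?f p x = 0}"
  have f: "mat_linear (corner n k) (?f p)" if p: "p \<in> unipotent_pairs" for p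
  proof -
    have "root_vector n (fst p) (snd p) \<in> \<qq>"
      using p kn by (intro root_vector_in_q) (auto simp: unipotent_pairs_def)
    from mat_linear_bracket(1)[OF mat_subspace_q bracket_q lin this]
    show ?thesis by (rule mat_linear_mono[OF _ corner_subset_q])
  qed
  have "?K \<subseteq> stabiliser \<qq> \<eta>"
  proof
    fix t assume t: "t \<in> ?K"
    hence tq: "t \<in> \<qq>" using corner_subset_q by blast
    note L = mat_linear_bracket(2)[OF mat_subspace_q bracket_q lin tq]
    \<comment> \<open>It suffices that this subspace contains all root vectors at \<open>P\<close>
      positions, because they span the nilradical.\<close>
    let ?W = "{y \<in> \<qq>. \<eta> (bracket t y) = 0}"
    have W: "mat_subspace (2 * n) ?W" by (rule mat_subspace_kernel[OF mat_subspace_q L])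
    have small: "root_vector n r c \<in> ?W" if rc: "P r c" "c < k" for r c
    proof -
      have "(r, c) \<in> unipotent_pairs" using rc P_less[OF rc(1)] unfolding unipotent_pairs_def by simp
      moreover have "root_vector n r c \<in> \<qq>"
        using rc P_less[OF rc(1)] kn by (intro root_vector_in_q) auto
      ultimately show ?thesis using t by force
    qed
    have E: "root_vector n r c \<in> ?W" if rc: "r < 2 * n" "c < 2 * n" "P r c" for r c
    proof -
      \<comment> \<open>The upper left block, the lower right block and the rest. The second is the
        mirror image of the first; the third commutes with the corner.\<close>
      consider "c < k" | "2 * n - k \<le> r" | "r < 2 * n - k" "k \<le> c" by linarith
      thus ?thesis
      proof cases
        case 1
        thus ?thesis using small rc(3) by blast
      next
        case 2
        have o: "opp n r < k" using 2 rc(1) kn unfolding opp_def by auto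
        have "root_vector n r c = - (block_sign n (opp n c) * block_sign n (opp n r)) \<cdot>\<^sub>m
            root_vector n (opp n c) (opp n r)"
          using root_vector_opp[of "opp n c" n "opp n r"] rc(1,2) by simp
        thus ?thesis using mat_subspaceD(4)[OF W small[OF P_opp[OF rc] o]] by simp
      next
        case 3
        thus ?thesis
          using bracket_corner_root_vector[of t r c] t rc root_vector_in_q[OF rc]
            mat_linear_zero[OF mat_subspace_q lin] by simp
      qed
    qed
    have "y \<in> ?W" if y: "y \<in> \<qq>" for y
      by (rule sp_mem_subspace[OF W supported_sp[OF y]]) (use E supported_index[OF y] in blast)
    thus "t \<in> stabiliser \<qq> \<eta>" using tq unfolding stabiliser_def by blast
  qed
  hence sub: "?K \<subseteq> stabiliser \<qq> \<eta> \<inter> corner n k" by blast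
  have "mat_dim (2 * n) ?K \<le> mat_dim (2 * n) (stabiliser \<qq> \<eta> \<inter> corner n k)"
    using sub by (intro mat_dim_mono(1) mat_subspace_kernels[OF S f] mat_subspace_Int[OF _ S]
        mat_subspace_stabiliser[OF mat_subspace_q bracket_q lin])
  moreover have "mat_dim (2 * n) (corner n k) \<le> mat_dim (2 * n) ?K + card unipotent_pairs"
    by (rule mat_dim_kernels[OF finite_pairs(1) S f])
  ultimately show ?thesis unfolding mat_dim_corner_pairs by linarith
qed

section \<open>Stabilisers of the forms given by symmetric matrices\<close>

definition form :: "(nat \<Rightarrow> nat \<Rightarrow> complex) \<Rightarrow> complex mat \<Rightarrow> complex" where
  "form F = restrict (corner_form n k F) \<qq>"

lemma form_in_dual_space: "form F \<in> dual_space \<qq>"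
proof -
  have "mat_linear \<qq> (corner_form n k F)"
  proof -
    have d: "dim_row x = 2 * n" "dim_col x = 2 * n" if "x \<in> \<qq>" for x
      using that mat_subspaceD(1)[OF mat_subspace_q] by auto
    have b: "b < 2 * n" "opp n b < 2 * n" if "b < k" for b using that kn by auto
    have "corner_form n k F (x + y) = corner_form n k F x + corner_form n k F y"
      if "x \<in> \<qq>" "y \<in> \<qq>" for x y
      unfolding corner_form_def sum.distrib[symmetric]
      using d that b by (intro sum.cong refl) (simp add: ring_distribs)
    moreover have "corner_form n k F (c \<cdot>\<^sub>m x) = c * corner_form n k F x" if "x \<in> \<qq>" for c x
      unfolding corner_form_def sum_distrib_left
      using d that b by (intro sum.cong refl) simp
    ultimately show ?thesis unfolding mat_linear_def by blast
  qed
  thus ?thesis unfolding form_def by (rule restrict_in_dual_space[OF mat_subspace_q])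
qed

lemma stabiliser_form_iff:
  assumes F: "\<And>a b. F a b = F b a" and x: "x \<in> \<qq>"
  shows "x \<in> stabiliser \<qq> (form F) \<longleftrightarrow>
    (\<forall>y\<in>\<qq>. (\<Sum>a<k. \<Sum>l<2 * n. row_form k F x a l * y $$ (l, opp n a)) = 0)"
proof -
  have "form F (bracket x y) = 2 * (\<Sum>a<k. \<Sum>l<2 * n. row_form k F x a l * y $$ (l, opp n a))"
    if y: "y \<in> \<qq>" for y
    using corner_form_bracket[OF kn F supported_sp[OF x] supported_sp[OF y]] bracket_q[OF x y]
    unfolding form_def by simp
  thus ?thesis using x unfolding stabiliser_def by auto
qed

text \<open>The test element is the root vector at \<open>(l, opp n a)\<close>. Its mirror entry at
  \<open>(a, opp n l)\<close> lies in the last \<open>k\<close> columns only if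
  \<open>l < k\<close>, and then enters with a plus sign. So \<open>l < k\<close> gives skewness,
  and \<open>k \<le> l\<close> the vanishing of an entry of \<open>F\<close> times
  \<open>x\<close>.\<close>

lemma stabiliser_form_test:
  assumes F: "\<And>a b. F a b = F b a" and x: "x \<in> stabiliser \<qq> (form F)"
    and al: "a < k" "l < 2 * n" "P l (opp n a)"
  shows "row_form k F x a l + (if l < k then row_form k F x l a else 0) = 0"
proof -
  have xq: "x \<in> \<qq>" using x unfolding stabiliser_def by blast
  have a: "a < 2 * n" "a < n" "opp n a < 2 * n" "block_sign n (opp n a) = -1"
    using al kn by (auto simp: block_sign_def opp_def)
  let ?R = "row_form k F x"
  let ?y = "root_vector n l (opp n a)"
  have "?y \<in> \<qq>" using root_vector_in_q[OF al(2) a(3) al(3)] .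
  hence "0 = (\<Sum>b<k. \<Sum>m<2 * n. ?R b m * ?y $$ (m, opp n b))"
    using stabiliser_form_iff[OF F xq] x by simp
  also have "\<dots> = (\<Sum>b<k. \<Sum>m<2 * n. (if m = l then if b = a then ?R a l else 0 else 0)
      + (if m = a then if b = l then ?R l a else 0 else 0))"
  proof (intro sum.cong refl)
    fix b m assume "b \<in> {..<k}" "m \<in> {..<2 * n}"
    hence bm: "b < k" "b < 2 * n" "opp n b < 2 * n" "m < 2 * n" using kn by auto
    have o: "(opp n b = opp n a) = (b = a)" "(opp n b = opp n l) = (b = l)"
      using bm(2) a(1) al(2) unfolding opp_def by auto
    have "block_sign n l = 1" if "b = l" using that bm(1) kn unfolding block_sign_def by simp
    thus "?R b m * ?y $$ (m, opp n b) = (if m = l then if b = a then ?R a l else 0 else 0)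
        + (if m = a then if b = l then ?R l a else 0 else 0)"
      unfolding root_vector_index[OF bm(4,3)] o opp_opp[OF a(1)] a(4) by auto
  qed
  also have "\<dots> = ?R a l + (if l < k then ?R l a else 0)"
    using al a by (simp add: sum.distrib)
  finally show ?thesis by simp
qed

text \<open>Tests with \<open>l < k\<close> make \<open>u\<close> skew for the form; tests with
  \<open>k \<le> l < 2 * n - k\<close> put the columns of \<open>a\<close> into its kernel. Both
  parts vanish.\<close>

lemma stabiliser_gram_sub_corner:
  assumes ij: "i < k" "j < k" "\<mu> = 0 \<or> i < j"
  shows "stabiliser \<qq> (form (gram i j \<mu>)) \<subseteq> corner n k"
proof
  fix x assume x: "x \<in> stabiliser \<qq> (form (gram i j \<mu>))"
  hence xq: "x \<in> \<qq>" unfolding stabiliser_def by blast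
  note test = stabiliser_form_test[OF gram_sym x]
  \<comment> \<open>All these tests are available, because \<open>(l, opp n a)\<close> crosses the
    cut at \<open>2 * n - k\<close>.\<close>
  have cross: "P l (opp n a)" if "a < k" "l < 2 * n - k" for a l
  proof -
    have "k \<le> opp n l" "l < 2 * n" "a < 2 * n" using that kn unfolding opp_def by auto
    thus ?thesis using P_opp[OF _ _ P_cross[OF that(1), of "opp n l"]] by simp
  qed
  have low: "x $$ (a, b) = 0" if "a < k" "b < k" "b \<le> a" for a b
    using supported_index[OF xq, of a b] P_less[of a b] that kn by auto
  have tri: "x $$ (a, b) = 0" if ab: "a < k" "b < k" for a b
  proof (rule gram_skew_triangular[OF ij, where u = "\<lambda>a b. x $$ (a, b)"])
    show "(\<Sum>m<k. gram i j \<mu> a m * x $$ (m, b)) + (\<Sum>m<k. gram i j \<mu> b m * x $$ (m, a)) = 0"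
      if "a < k" "b < k" for a b
      using test[of a b] cross[of a b] that kn by simp
  qed (use low ab in auto)
  have mid: "x $$ (a, l) = 0" if al: "a < k" "k \<le> l" "l < 2 * n - k" for a l
  proof (rule gram_injective[OF ij _ al(1), where z = "\<lambda>a. x $$ (a, l)"])
    show "(\<Sum>b<k. gram i j \<mu> a b * x $$ (b, l)) = 0" if "a < k" for a
      using test[of a l] cross[of a l] that al by simp
  qed
  have top: "x $$ (r, c) = 0" if "r < k" "c < 2 * n - k" for r c
    using tri[of r c] mid[of r c] that by (cases "c < k") auto
  show "x \<in> corner n k" unfolding corner_def
  proof (rule supportedI[OF supported_sp[OF xq]], rule ccontr)
    fix r c assume rc: "r < 2 * n" "c < 2 * n" "x $$ (r, c) \<noteq> 0" and n: "\<not> (r < k \<and> 2 * n - k \<le> c)"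
    have Prc: "P r c" using supported_index[OF xq rc(1,2)] rc(3) by blast
    \<comment> \<open>A position outside the corner is to its left in the first \<open>k\<close>
      rows, in the middle square, or the mirror image of a position of the first kind.\<close>
    have "x $$ (opp n c, opp n r) \<noteq> 0"
      using rc(3) sp_index[OF supported_sp[OF xq] rc(1,2)] by auto
    hence "\<not> (opp n c < k \<and> opp n r < 2 * n - k)" using top by blast
    moreover have "\<not> (r < k \<and> c < 2 * n - k)" using top rc(3) by blast
    moreover have "\<not> (k \<le> r \<and> c < 2 * n - k)" using P_middle Prc by blast
    ultimately show False using n rc(1,2) kn unfolding opp_def by auto
  qed
qed

lemma mat_dim_stabiliser_gram:
  assumes ij: "i < k" "j < k" "\<mu> = 0 \<or> i < j"
  shows "mat_dim (2 * n) (stabiliser \<qq> (form (gram i j \<mu>))) \<le> card block_pairs"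
proof -
  let ?T = "stabiliser \<qq> (form (gram i j \<mu>))"
  have T: "mat_subspace (2 * n) ?T"
    by (rule mat_subspace_stabiliser[OF mat_subspace_q bracket_q
          dual_space_linear[OF form_in_dual_space]])
  let ?f = "\<lambda>p x. x $$ (fst p, opp n (snd p)) :: complex"
  have f: "mat_linear ?T (?f p)" if "p \<in> block_pairs" for p
    using that kn by (intro mat_linear_index[OF mat_subspaceD(1)[OF T]])
      (auto simp: block_pairs_def)
  have "x = 0\<^sub>m (2 * n) (2 * n)" if x: "x \<in> ?T" "\<forall>p\<in>block_pairs. ?f p x = 0" for x
  proof -
    have xS: "x \<in> corner n k" using stabiliser_gram_sub_corner[OF ij] x(1) by blast
    hence xs: "x \<in> sp n" unfolding corner_def by (rule supported_sp)
    have sym: "x $$ (a, opp n b) = x $$ (b, opp n a)" if "a < k" "b < k" for a b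
    proof -
      have "a < 2 * n" "b < 2 * n" "block_sign n a * block_sign n (opp n b) = -1"
        using that kn unfolding block_sign_def opp_def by auto
      thus ?thesis using sp_index[OF xs, of a "opp n b"] by simp
    qed
    have Plt: "P (opp n b) (opp n a)" if "P a b" "a < k" "b < k" for a b
      using P_opp[OF _ _ that(1)] that kn by auto
    have "x $$ (a, opp n b) = 0" if ab: "a < k" "b < k" for a b
    proof (rule gram_block_triangular[OF ij, where P = P and t = "\<lambda>a b. x $$ (a, opp n b)"])
      show "a < b" if "P a b" for a b using P_less that .
      show "P a' b" if "P a b" "a' \<le> a" for a a' b using P_mono that .
      show "x $$ (a, opp n b) = x $$ (b, opp n a)" if "a < k" "b < k" for a b using sym that .
      show "x $$ (a, opp n b) = 0" if "a < k" "b < k" "\<not> P a b" "\<not> P b a" for a b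
      proof (cases "a \<le> b")
        case True
        hence "(a, b) \<in> block_pairs" using that unfolding block_pairs_def by simp
        thus ?thesis using x(2) by force
      next
        case False
        hence "(b, a) \<in> block_pairs" using that unfolding block_pairs_def by simp
        thus ?thesis using x(2) sym[of a b] that by force
      qed
      show "(\<Sum>m<k. gram i j \<mu> a m * x $$ (m, opp n b)) = 0"
        if "a < k" "b < k" "P a b" for a b
      proof -
        \<comment> \<open>The test index \<open>l = opp n b\<close> is at least \<open>k\<close>, so
          the second term drops out and the form times the corner block vanishes at
          \<open>(a, b)\<close>.\<close>
        have "b < n" using that kn by simp
        hence "opp n b < 2 * n" "\<not> opp n b < k" using kn unfolding opp_def by auto
        thus ?thesis using stabiliser_form_test[OF gram_sym x(1) that(1) _ Plt[OF that(3,1,2)]]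
          by simp
      qed
    qed (use ab in auto)
    thus ?thesis using corner_index_zero[OF xS kn] by auto
  qed
  hence sub: "{x \<in> ?T. \<forall>p\<in>block_pairs. ?f p x = 0} \<subseteq> {0\<^sub>m (2 * n) (2 * n)}" by blast
  have Z: "mat_subspace (2 * n) {0\<^sub>m (2 * n) (2 * n)}" by (rule mat_subspaceI) auto
  have "mat_dim (2 * n) {x \<in> ?T. \<forall>p\<in>block_pairs. ?f p x = 0} \<le> 0"
    using mat_dim_mono(1)[OF mat_subspace_kernels[where f = ?f, OF T f] Z sub]
    unfolding mat_dim_zero .
  thus ?thesis using mat_dim_kernels[where f = ?f, OF finite_pairs(2) T f] by simp
qed

lemma form_gram_regular:
  assumes ij: "i < k" "j < k" "\<mu> = 0 \<or> i < j"
  shows "form (gram i j \<mu>) \<in> dual_reg (2 * n) \<qq>"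
  unfolding dual_reg_def
proof (intro CollectI conjI ballI)
  show "form (gram i j \<mu>) \<in> dual_space \<qq>" by (rule form_in_dual_space)
  fix \<eta> assume \<eta>: "\<eta> \<in> dual_space \<qq>"
  note T = mat_subspace_stabiliser[OF mat_subspace_q bracket_q dual_space_linear[OF \<eta>]]
  have "mat_dim (2 * n) (stabiliser \<qq> (form (gram i j \<mu>))) \<le> card block_pairs"
    by (rule mat_dim_stabiliser_gram[OF ij])
  also have "\<dots> \<le> mat_dim (2 * n) (stabiliser \<qq> \<eta> \<inter> corner n k)"
    by (rule card_block_pairs_le[OF \<eta>])
  also have "\<dots> \<le> mat_dim (2 * n) (stabiliser \<qq> \<eta>)"
    by (intro mat_dim_mono(1) mat_subspace_Int T mat_subspace_corner) auto
  finally show "mat_dim (2 * n) (stabiliser \<qq> (form (gram i j \<mu>))) \<le> mat_dim (2 * n) (stabiliser \<qq> \<eta>)" .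
qed

text \<open>The chain of inequalities starts at the stabiliser and ends at its intersection with the
  corner, so the dimensions, and hence the spaces, agree. \<open>gram 0 0 0\<close> is the identity
  form.\<close>

lemma regular_stabiliser_sub_corner:
  assumes \<eta>: "\<eta> \<in> dual_reg (2 * n) \<qq>" and k: "1 \<le> k"
  shows "stabiliser \<qq> \<eta> \<subseteq> corner n k"
proof -
  have \<eta>': "\<eta> \<in> dual_space \<qq>" using \<eta> unfolding dual_reg_def by blast
  note T = mat_subspace_stabiliser[OF mat_subspace_q bracket_q dual_space_linear[OF \<eta>']]
  note TS = mat_subspace_Int[OF T mat_subspace_corner[of n k]]
  have "mat_dim (2 * n) (stabiliser \<qq> \<eta>) \<le> mat_dim (2 * n) (stabiliser \<qq> (form (gram 0 0 0)))"
    using \<eta> form_in_dual_space unfolding dual_reg_def by blast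
  also have "\<dots> \<le> card block_pairs" using k by (intro mat_dim_stabiliser_gram) auto
  also have "\<dots> \<le> mat_dim (2 * n) (stabiliser \<qq> \<eta> \<inter> corner n k)"
    by (rule card_block_pairs_le[OF \<eta>'])
  finally have "mat_dim (2 * n) (stabiliser \<qq> \<eta> \<inter> corner n k) = mat_dim (2 * n) (stabiliser \<qq> \<eta>)"
    using mat_dim_mono(1)[OF TS T] by simp
  hence "stabiliser \<qq> \<eta> \<inter> corner n k = stabiliser \<qq> \<eta>"
    by (intro mat_dim_mono(2)[OF TS T]) auto
  thus ?thesis by blast
qed

section \<open>The regular stabilisers span the corner\<close>

lemma corner_square_in_corner: "corner_square n k v \<in> corner n k"
  unfolding corner_def
proof (rule supportedI)
  show "corner_square n k v \<in> sp n"
    unfolding sp_iff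
  proof (intro conjI allI impI)
    fix r c assume rc: "r < 2 * n" "c < 2 * n"
    have "(opp n c < k \<and> 2 * n - k \<le> opp n r) = (r < k \<and> 2 * n - k \<le> c)"
      using rc kn unfolding opp_def by auto
    moreover have "block_sign n r * block_sign n c = -1" if "r < k \<and> 2 * n - k \<le> c"
      using that kn unfolding block_sign_def by auto
    ultimately show "corner_square n k v $$ (r, c) =
        - (block_sign n r * block_sign n c * corner_square n k v $$ (opp n c, opp n r))"
      using rc unfolding corner_square_def by simp
  qed (simp add: corner_square_def)
qed (auto simp: corner_square_def split: if_splits)

text \<open>The vector is \<open>v = g^-1 e_j\<close>, so \<open>F v = g^T e_j = e_j\<close>. Thus
  \<open>F v v^T\<close> has only row \<open>j\<close>, and the support of \<open>v\<close> lies in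
  the indices up to \<open>j\<close>.\<close>

lemma corner_square_in_stabiliser:
  assumes ij: "i < k" "j < k" "\<mu> = 0 \<or> i < j"
  shows "corner_square n k (\<lambda>a. (if a = j then 1 else 0) + (if a = i then \<mu> else 0))
    \<in> stabiliser \<qq> (form (gram i j \<mu>))"
proof -
  define v where "v = (\<lambda>a. (if a = j then 1 else 0) + (if a = i then \<mu> else 0))"
  let ?x = "corner_square n k v"
  have Gv: "(\<Sum>b<k. gram i j \<mu> a b * v b) = (if a = j then 1 else 0)" if "a < k" for a
    using ij by (auto simp: sum_gram[OF that ij(1,2)] v_def power2_eq_square)
  have xq: "?x \<in> \<qq>" using corner_square_in_corner corner_subset_q by blast
  have "row_form k (gram i j \<mu>) ?x a l * y $$ (l, opp n a) = 0"
    if y: "y \<in> \<qq>" and al: "a < k" "l < 2 * n" for y a l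
  proof (rule ccontr)
    assume nz: "row_form k (gram i j \<mu>) ?x a l * y $$ (l, opp n a) \<noteq> 0"
    have a: "a < 2 * n" "opp n a < 2 * n" using al kn by auto
    have "P l (opp n a)" using supported_index[OF y al(2) a(2)] nz by auto
    \<comment> \<open>After reflection the support of \<open>y\<close> requires
      \<open>a < opp n l\<close>, whereas a nonzero row forces \<open>a = j\<close> and
      \<open>opp n l \<le> j\<close>.\<close>
    hence Pa: "P a (opp n l)" using P_opp[OF al(2) a(2)] a(1) by simp
    have row: "row_form k (gram i j \<mu>) ?x a l =
        (if 2 * n - k \<le> l then (if a = j then 1 else 0) * v (opp n l) else 0)"
    proof (cases "2 * n - k \<le> l")
      case True
      have "row_form k (gram i j \<mu>) ?x a l = (\<Sum>b<k. gram i j \<mu> a b * v b * v (opp n l))"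
        using al True kn by (intro sum.cong) (auto simp: corner_square_def)
      thus ?thesis using Gv[OF al(1)] True by (simp add: sum_distrib_right[symmetric])
    next
      case False
      thus ?thesis using al kn by (auto simp: corner_square_def intro!: sum.neutral)
    qed
    hence "a = j" "v (opp n l) \<noteq> 0" using nz by (auto split: if_splits)
    hence "opp n l \<le> a" using ij unfolding v_def by (auto split: if_splits)
    thus False using P_less[OF Pa] by simp
  qed
  hence "?x \<in> stabiliser \<qq> (form (gram i j \<mu>))"
    unfolding stabiliser_form_iff[OF gram_sym xq] by (intro ballI sum.neutral) simp
  thus ?thesis unfolding v_def .
qed

lemma frobenius_semiradical_eq_corner:
  assumes k: "1 \<le> k"
  shows "frobenius_semiradical (2 * n) \<qq> = corner n k"
proof
  let ?U = "\<Union>\<eta>\<in>dual_reg (2 * n) \<qq>. stabiliser \<qq> \<eta>"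
  have US: "?U \<subseteq> corner n k" using regular_stabiliser_sub_corner k by blast
  thus "frobenius_semiradical (2 * n) \<qq> \<subseteq> corner n k"
    unfolding frobenius_semiradical_def subspaces_sum_def
    by (rule mat_span_least[OF _ mat_subspace_corner])
  let ?W = "mat_span (2 * n) ?U"
  have UC: "?U \<subseteq> carrier_mat (2 * n) (2 * n)"
    using US mat_subspaceD(1)[OF mat_subspace_corner[of n k]] by (rule subset_trans)
  note W = mat_subspace_span[OF UC]
  let ?e = "\<lambda>i j \<mu> a. (if a = j then 1 else 0) + (if a = i then \<mu> else 0) :: complex"
  have sq: "corner_square n k (?e i j \<mu>) \<in> ?W" if "i < k" "j < k" "\<mu> = 0 \<or> i < j" for i j \<mu>
    using corner_square_in_stabiliser[OF that] form_gram_regular[OF that] mat_span_superset[OF UC]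
    by blast
  have diag: "root_vector n i (opp n i) \<in> ?W" if i: "i < k" for i
  proof -
    have "root_vector n i (opp n i) = 2 \<cdot>\<^sub>m corner_square n k (?e i i 0)"
    proof (rule eq_matI)
      fix r c assume "r < dim_row (2 \<cdot>\<^sub>m corner_square n k (?e i i 0))"
        "c < dim_col (2 \<cdot>\<^sub>m corner_square n k (?e i i 0))"
      hence rc: "r < 2 * n" "c < 2 * n" by (auto simp: corner_square_def)
      have "(opp n c = i) = (c = opp n i)" "opp n (opp n i) = i" "c = opp n i \<Longrightarrow> 2 * n - k \<le> c"
        "block_sign n i * block_sign n (opp n i) = -1"
        using rc i kn unfolding opp_def block_sign_def by auto
      thus "root_vector n i (opp n i) $$ (r, c) = (2 \<cdot>\<^sub>m corner_square n k (?e i i 0)) $$ (r, c)"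
        using rc i unfolding root_vector_index[OF rc] by (auto simp: corner_square_def)
    qed (auto simp: corner_square_def root_vector_def)
    thus ?thesis using mat_subspaceD(4)[OF W sq[of i i 0]] i by simp
  qed
  have off: "root_vector n i (opp n j) \<in> ?W" if ij: "i < j" "j < k" for i j
  proof -
    \<comment> \<open>Polarisation: removing both diagonal squares from that of
      \<open>e_i + e_j\<close> leaves the two mixed terms, which are the two entries of the root
      vector.\<close>
    let ?m = "corner_square n k (?e i j 1) + (-1) \<cdot>\<^sub>m (corner_square n k (?e i i 0) + corner_square n k (?e j j 0))"
    have "root_vector n i (opp n j) = ?m"
    proof (rule eq_matI)
      fix r c assume "r < dim_row ?m" "c < dim_col ?m"
      hence rc: "r < 2 * n" "c < 2 * n" by (auto simp: corner_square_def)
      have "(opp n c = i) = (c = opp n i)" "(opp n c = j) = (c = opp n j)" "opp n (opp n j) = j"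
        "c = opp n i \<Longrightarrow> 2 * n - k \<le> c" "c = opp n j \<Longrightarrow> 2 * n - k \<le> c"
        "block_sign n i * block_sign n (opp n j) = -1" "opp n i \<noteq> opp n j"
        using rc ij kn unfolding opp_def block_sign_def by auto
      thus "root_vector n i (opp n j) $$ (r, c) = ?m $$ (r, c)"
        using rc ij unfolding root_vector_index[OF rc] by (auto simp: corner_square_def)
    qed (auto simp: corner_square_def root_vector_def)
    moreover have "?m \<in> ?W"
      using ij by (intro mat_subspaceD(3,4)[OF W] sq) auto
    ultimately show ?thesis by simp
  qed
  show "corner n k \<subseteq> frobenius_semiradical (2 * n) \<qq>"
    unfolding frobenius_semiradical_def subspaces_sum_def
  proof
    fix x assume x: "x \<in> corner n k"
    show "x \<in> ?W"
    proof (rule sp_mem_subspace[OF W])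
      show "x \<in> sp n" using x supported_sp unfolding corner_def by blast
      fix r c assume rc: "r < 2 * n" "c < 2 * n" "x $$ (r, c) \<noteq> 0"
      hence b: "r < k" "2 * n - k \<le> c" using supported_index[OF x[unfolded corner_def]] by blast+
      define j where "j = opp n c"
      have j: "j < k" "c = opp n j" using b rc kn unfolding j_def opp_def by auto
      consider "r = j" | "r < j" | "j < r" by linarith
      thus "root_vector n r c \<in> ?W"
      proof cases
        case 3
        have "block_sign n j * block_sign n (opp n r) = -1"
          using b(1) j(1) kn unfolding block_sign_def opp_def by auto
        hence "root_vector n r c = - (-1) \<cdot>\<^sub>m root_vector n j (opp n r)"
          using root_vector_opp[of j n "opp n r"] b(1) j kn by simp
        thus ?thesis using mat_subspaceD(4)[OF W off[OF 3 b(1)], of "- (-1)"] by simp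
      qed (use diag off j b in auto)
    qed
  qed
qed

end

section \<open>The corner as north-east square and as sum of root spaces\<close>

lemma north_east_square_eq_corner:
  assumes "1 \<le> k" "k \<le> n"
  shows "north_east_square n k = corner n k"
proof -
  have n: "1 \<le> n" using assms by simp
  have nil: "nilradical n {simple_root n n} = supported n (parabolic_pair n {n})"
    using nilradical_eq_supported[of "{n}" n] n by simp
  have pp: "parabolic_pair n {n} r c \<longleftrightarrow> r < n \<and> n \<le> c" for r c
    unfolding parabolic_pair_def by auto
  show ?thesis
  proof (intro equalityI subsetI)
    fix x assume "x \<in> north_east_square n k"
    then obtain M where M: "x = upper_right n M" "M \<in> carrier_mat n n" "x \<in> nilradical n {simple_root n n}"
      "\<forall>i<n. \<forall>j<n. M $$ (i, j) \<noteq> 0 \<longrightarrow> i < k \<and> n - k \<le> j"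
      unfolding north_east_square_def by blast
    have x: "x \<in> supported n (parabolic_pair n {n})" using M(3) nil by simp
    show "x \<in> corner n k" unfolding corner_def
    proof (rule supportedI[OF supported_sp[OF x]])
      fix r c assume rc: "r < 2 * n" "c < 2 * n" "x $$ (r, c) \<noteq> 0"
      hence b: "r < n" "n \<le> c" using supported_index[OF x rc(1,2)] pp by blast+
      hence "x $$ (r, c) = M $$ (r, c - n)" using M(1,2) rc unfolding upper_right_def by auto
      hence "r < k \<and> n - k \<le> c - n" using M(4) b rc by (metis add_less_imp_less_right le_add_diff_inverse2 mult_2)
      thus "r < k \<and> 2 * n - k \<le> c" using b assms by auto
    qed
  next
    fix x assume x: "x \<in> corner n k"
    note xi = supported_index[OF x[unfolded corner_def]]
    have xs: "x \<in> sp n" using x supported_sp unfolding corner_def by blast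
    have xc: "x \<in> carrier_mat (2 * n) (2 * n)" using sp_carrier[OF xs] .
    define M where "M = mat n n (\<lambda>(i, j). x $$ (i, j + n))"
    have "x = upper_right n M"
    proof (rule eq_matI)
      fix r c assume "r < dim_row (upper_right n M)" "c < dim_col (upper_right n M)"
      hence rc: "r < 2 * n" "c < 2 * n" by (auto simp: upper_right_def)
      show "x $$ (r, c) = upper_right n M $$ (r, c)"
        using rc xi[OF rc] assms unfolding upper_right_def M_def
        by (cases "r < k \<and> 2 * n - k \<le> c") auto
    qed (use xc in \<open>auto simp: upper_right_def\<close>)
    moreover have "x \<in> nilradical n {simple_root n n}"
      unfolding nil
    proof (rule supportedI[OF xs])
      fix r c assume rc: "r < 2 * n" "c < 2 * n" "x $$ (r, c) \<noteq> 0"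
      hence "r < k \<and> 2 * n - k \<le> c" using xi by blast
      thus "parabolic_pair n {n} r c" unfolding pp using assms by auto
    qed
    moreover have "i < k \<and> n - k \<le> j" if "i < n" "j < n" "M $$ (i, j) \<noteq> 0" for i j
      using that xi[of i "j + n"] assms unfolding M_def by fastforce
    moreover have "M \<in> carrier_mat n n" unfolding M_def by simp
    ultimately show "x \<in> north_east_square n k" unfolding north_east_square_def by blast
  qed
qed

lemma corner_direct_sum:
  assumes "k \<le> n"
  shows "is_internal_direct_sum (2 * n) (corner n k)
    {eps n i + eps n j | i j. 1 \<le> i \<and> i \<le> j \<and> j \<le> k} (root_space n)"
proof -
  let ?G = "{eps n i + eps n j | i j. 1 \<le> i \<and> i \<le> j \<and> j \<le> k}"
  have Gc: "\<gamma> \<in> carrier_vec n" if "\<gamma> \<in> ?G" for \<gamma> using that unfolding eps_def by auto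
  have finG: "finite ?G"
    by (rule finite_subset[of _ "(\<lambda>(i, j). eps n i + eps n j) ` ({..k} \<times> {..k})"]) force+
  let ?U = "\<Union>\<gamma>\<in>?G. root_space n \<gamma>"
  have US: "?U \<subseteq> corner n k"
  proof
    fix x assume "x \<in> ?U"
    then obtain i j where ij: "1 \<le> i" "i \<le> j" "j \<le> k" "x \<in> root_space n (eps n i + eps n j)" by blast
    let ?r = "i - 1" and ?c = "opp n (j - 1)"
    have \<gamma>: "eps n i + eps n j = weight_diff n ?r ?c"
      using ij assms by (intro eps_add_eq_weight_diff) auto
    have rc: "?r < 2 * n" "?c < 2 * n" "?r < k" "2 * n - k \<le> ?c" using ij assms by (auto simp: opp_def)
    \<comment> \<open>A grading element: its value on the root at a position is 2 in the corner and
      at most 1 elsewhere.\<close>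
    let ?d = "\<lambda>m. if m < k then 1 else 0 :: complex"
    have t: "torus_entry n a ?d = (if a < k then 1 else 0) - (if 2 * n - k \<le> a then 1 else 0)"
      if "a < 2 * n" for a
      using that assms unfolding torus_entry_def opp_def by auto
    show "x \<in> corner n k" unfolding corner_def
    proof (rule supportedI)
      show "x \<in> sp n" using ij(4) root_space_sub_sp by blast
      fix a b assume ab: "a < 2 * n" "b < 2 * n" "x $$ (a, b) \<noteq> 0"
      have "weight_diff n ?r ?c = weight_diff n a b"
        using root_space_entry[OF ij(4)[unfolded \<gamma>] _ ab] by simp
      hence "pairing n (weight_diff n ?r ?c) ?d = pairing n (weight_diff n a b) ?d" by simp
      thus "a < k \<and> 2 * n - k \<le> b"
        unfolding pairing_root[OF rc(1,2)] pairing_root[OF ab(1,2)] t[OF rc(1)] t[OF rc(2)]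
          t[OF ab(1)] t[OF ab(2)]
        using rc(3,4) assms by (auto split: if_splits)
    qed
  qed
  have UC: "?U \<subseteq> carrier_mat (2 * n) (2 * n)"
    using US mat_subspaceD(1)[OF mat_subspace_corner[of n k]] by (rule subset_trans)
  have "corner n k = mat_span (2 * n) ?U"
  proof
    show "mat_span (2 * n) ?U \<subseteq> corner n k" by (rule mat_span_least[OF US mat_subspace_corner])
    show "corner n k \<subseteq> mat_span (2 * n) ?U"
    proof
      fix x assume x: "x \<in> corner n k"
      show "x \<in> mat_span (2 * n) ?U"
      proof (rule sp_mem_subspace[OF mat_subspace_span[OF UC]])
        show "x \<in> sp n" using x supported_sp unfolding corner_def by blast
        fix r c assume rc: "r < 2 * n" "c < 2 * n" "x $$ (r, c) \<noteq> 0"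
        hence b: "r < k" "2 * n - k \<le> c" using supported_index[OF x[unfolded corner_def]] by blast+
        define j where "j = opp n c + 1"
        have j: "1 \<le> j" "j \<le> k" "opp n (j - 1) = c" using b rc assms unfolding j_def opp_def by auto
        have \<gamma>: "weight_diff n r c = eps n (r + 1) + eps n j"
          using eps_add_eq_weight_diff[of "r + 1" n j] j b assms by simp
        have "weight_diff n r c \<in> ?G"
        proof (cases "r + 1 \<le> j")
          case True
          thus ?thesis unfolding \<gamma> using j b by (intro CollectI exI[of _ "r + 1"] exI[of _ j]) auto
        next
          case False
          have "eps n (r + 1) + eps n j = eps n j + eps n (r + 1)"
            unfolding eps_def by (intro comm_add_vec[of _ n]) auto
          thus ?thesis unfolding \<gamma> using j b False
            by (intro CollectI exI[of _ j] exI[of _ "r + 1"]) auto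
        qed
        thus "root_vector n r c \<in> mat_span (2 * n) ?U"
          using root_vector_in_root_space[OF rc(1,2)] mat_span_superset[OF UC] by blast
      qed
    qed
  qed
  moreover have "f \<gamma> = 0\<^sub>m (2 * n) (2 * n)"
    if f: "f \<in> Pi ?G (root_space n)" "finsum (mat_space (2 * n)) f ?G = 0\<^sub>m (2 * n) (2 * n)"
      and \<gamma>: "\<gamma> \<in> ?G" for f \<gamma>
  proof -
    have fr: "f \<delta> \<in> root_space n \<delta>" if "\<delta> \<in> ?G" for \<delta> using f(1) that by (rule Pi_mem)
    have fc: "f \<delta> \<in> carrier_mat (2 * n) (2 * n)" if "\<delta> \<in> ?G" for \<delta>
      using fr[OF that] root_space_sub_sp sp_carrier by blast
    show ?thesis
    proof (rule eq_matI)
      fix r c assume "r < dim_row (0\<^sub>m (2 * n) (2 * n))" "c < dim_col (0\<^sub>m (2 * n) (2 * n))"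
      hence rc: "r < 2 * n" "c < 2 * n" by auto
      \<comment> \<open>A nonzero entry at \<open>(r, c)\<close> determines the root, so at most one
        summand contributes there and no cancellation is possible.\<close>
      have "f \<gamma> $$ (r, c) = 0"
      proof (rule ccontr)
        assume nz: "f \<gamma> $$ (r, c) \<noteq> 0"
        have g: "\<gamma> = weight_diff n r c" using root_space_entry[OF fr[OF \<gamma>] Gc[OF \<gamma>] rc nz] .
        have "f \<delta> $$ (r, c) = 0" if "\<delta> \<in> ?G - {\<gamma>}" for \<delta>
          using root_space_entry[OF fr[of \<delta>] Gc[of \<delta>] rc] that g by blast
        hence "(\<Sum>\<delta>\<in>?G. f \<delta> $$ (r, c)) = f \<gamma> $$ (r, c)"
          using sum.remove[OF finG \<gamma>, of "\<lambda>\<delta>. f \<delta> $$ (r, c)"] by simp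
        moreover have "(\<Sum>\<delta>\<in>?G. f \<delta> $$ (r, c)) = 0"
          using index_mat_finsum[of ?G f "2 * n" r c] finG fc rc f(2) by simp
        ultimately show False using nz by simp
      qed
      thus "f \<gamma> $$ (r, c) = 0\<^sub>m (2 * n) (2 * n) $$ (r, c)" using rc by simp
    qed (use fc[OF \<gamma>] in auto)
  qed
  ultimately show ?thesis unfolding is_internal_direct_sum_def subspaces_sum_def by blast
qed

theorem mainTheorem12:
  fixes n k :: nat and \<nn> :: "complex mat set"
  assumes "n \<ge> 1"
    and "is_nilradical n \<nn>"
    and "1 \<le> k" and "k \<le> n"
    and "kostant_cascade n \<inter> roots_of n \<nn> = kostant_root n ` {1..k}"
  shows "frobenius_semiradical (2 * n) \<nn> = north_east_square n k \<and>
         is_internal_direct_sum (2 * n) (frobenius_semiradical (2 * n) \<nn>)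
           {eps n i + eps n j | i j. 1 \<le> i \<and> i \<le> j \<and> j \<le> k} (root_space n) \<and>
         mat_dim (2 * n) (frobenius_semiradical (2 * n) \<nn>) = k * (k + 1) div 2"
proof -
  obtain J where J: "J \<subseteq> {1..k}" "k \<in> J" "\<nn> = supported n (parabolic_pair n J)"
    using is_nilradical_supported[OF assms(2-5)] .
  interpret cascade_nilradical n k J using J assms by unfold_locales
  have "frobenius_semiradical (2 * n) \<nn> = corner n k"
    using frobenius_semiradical_eq_corner[OF assms(3)] J(3) by simp
  thus ?thesis
    using north_east_square_eq_corner[OF assms(3,4)] corner_direct_sum[OF assms(4)]
      mat_dim_corner[OF assms(4)] by simp
qed

end
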